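(* Let $M$ be a homogeneous space of a Lie group $G$ with isotropy group $H$ at the origin, and let $\omega$ be a connection on $M$. The $\mathfrak g$-valued one-form $\theta$ on $G$ defined by $$\langle\theta,X\rangle_g := g^{-1}X - g^{-1}\,\langle\omega,[X]\rangle_{[g]}\,g,\qquad g\in G,\quad X\in T_gG,$$ takes values in $\mathfrak h$ and is an invariant principal connection.
   Context: $G$ is a Lie group (treated as a matrix group) with Lie algebra $\mathfrak g$, acting smoothly and transitively on a smooth manifold $M$ ($g\cdot x$ denotes the action, $\xi\cdot x\in T_xM$ the infinitesimal action of $\xi\in\mathfrak g$). A point $o\in M$ (the origin) is fixed; $H=\{g\in G: g\cdot o=o\}$ is the isotropy group, with Lie algebra $\mathfrak h$. $M$ is identified with the set of cosets $gH$; $\pi\colon G\to M$, $\pi(g)=[g]=gH\equiv g\cdot o$, is the projection, and $[X]:=T\pi\, X$ for $X\in T_gG$. $G$ acts on $\mathfrak g$ by $g\cdot\xi=g\xi g^{-1}$, and $Tg$ is the tangent map of $x\mapsto g\cdot x$. A connection is a $\mathfrak g$-valued one-form $\omega\in\Omega^1(M,\mathfrak g)$ such that $\langle\omega,f\rangle_x\cdot x=f$ for all $x\in M$, $f\in T_xM$ and $\langle\omega,Tg\,f\rangle_{g\cdot x}=g\cdot\langle\omega,f\rangle_x$ for all $g\in G$. A principal connection is an $\mathfrak h$-valued one-form $\theta$ on $G$ such that $\langle\theta,Xh\rangle_{gh}=h^{-1}\langle\theta,X\rangle_g h$ for all $h\in H$, $g\in G$, $X\in T_gG$, and $\langle\theta,g\xi\rangle_g=\xi$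 for all $g\in G$, $\xi\in\mathfrak h$. It is invariant if $\langle\theta,\bar gX\rangle_{\bar g g}=\langle\theta,X\rangle_g$ for all $\bar g,g\in G$ and $X\in T_gG$. *)

theory Defs
  imports "HOL-Analysis.Analysis" "HOL-Algebra.Group_Action"
begin

section \<open>Smooth manifolds\<close>

primrec Ck_on :: "nat \<Rightarrow> 'a::real_normed_vector set \<Rightarrow> ('a \<Rightarrow> 'b::real_normed_vector) \<Rightarrow> bool" where
  "Ck_on 0 S f \<longleftrightarrow> continuous_on S f"
| "Ck_on (Suc k) S f \<longleftrightarrow>
     (\<forall>x\<in>S. f differentiable (at x)) \<and> (\<forall>v. Ck_on k S (\<lambda>x. frechet_derivative f (at x) v))"

text \<open>Only used for open subsets of finite-dimensional spaces, where it is the usual notion.\<close>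
definition smooth_on :: "'a::real_normed_vector set \<Rightarrow> ('a \<Rightarrow> 'b::real_normed_vector) \<Rightarrow> bool" where
  "smooth_on S f \<longleftrightarrow> (\<forall>k. Ck_on k S f)"

text \<open>A chart is a pair of its domain and its coordinate map; outside the domain the values of the
  coordinate map are irrelevant.\<close>
type_synonym ('m, 'e) chart = "'m set \<times> ('m \<Rightarrow> 'e)"
type_synonym ('m, 'e) atlas = "('m, 'e) chart set"

definition chart_inv :: "('m, 'e) chart \<Rightarrow> 'e \<Rightarrow> 'm" where
  "chart_inv c = inv_into (fst c) (snd c)"

text \<open>The underlying set of a manifold is a whole type, which also carries the topology. The model
  space is a finite-dimensional inner product space rather than a type of class
  \<open>euclidean_space\<close>, because the latter has positive dimension and would exclude manifolds of
  dimension 0 (a point, or a discrete group).\<close>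
definition smooth_manifold ::
  "('m::{t2_space, second_countable_topology}, 'e::{real_inner, banach}) atlas \<Rightarrow> bool" where
  "smooth_manifold A \<longleftrightarrow>
     (\<exists>B::'e set. finite B \<and> span B = UNIV) \<and>
     (\<Union>(U, \<phi>)\<in>A. U) = UNIV \<and>
     (\<forall>(U, \<phi>)\<in>A. open U \<and> open (\<phi> ` U) \<and> (\<exists>\<psi>. homeomorphism U (\<phi> ` U) \<phi> \<psi>)) \<and>
     (\<forall>(U, \<phi>)\<in>A. \<forall>(V, \<psi>)\<in>A. smooth_on (\<phi> ` (U \<inter> V)) (\<psi> \<circ> chart_inv (U, \<phi>)))"

definition smooth_map ::
  "('m::topological_space, 'e::real_normed_vector) atlas \<Rightarrow>
   ('n::topological_space, 'f::real_normed_vector) atlas \<Rightarrow> ('m \<Rightarrow> 'n) \<Rightarrow> bool" where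
  "smooth_map A B f \<longleftrightarrow>
     continuous_on UNIV f \<and>
     (\<forall>(U, \<phi>)\<in>A. \<forall>(V, \<psi>)\<in>B. smooth_on (\<phi> ` (U \<inter> f -` V)) (\<psi> \<circ> f \<circ> chart_inv (U, \<phi>)))"

definition std_atlas :: "('e, 'e) atlas" where
  "std_atlas = {(UNIV, id)}"

definition prod_atlas :: "('m, 'e) atlas \<Rightarrow> ('n, 'f) atlas \<Rightarrow> ('m \<times> 'n, 'e \<times> 'f) atlas" where
  "prod_atlas A B = {(U \<times> V, map_prod \<phi> \<psi>) | U \<phi> V \<psi>. (U, \<phi>) \<in> A \<and> (V, \<psi>) \<in> B}"


section \<open>Tangent maps and one-forms\<close>

text \<open>For every point \<open>p\<close> one chart around \<open>p\<close> is selected once and for all, and the tangent space at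
  \<open>p\<close> is the model space: the vector \<open>v\<close> of the model space stands for the tangent vector at \<open>p\<close>
  whose coordinates in the selected chart around \<open>p\<close> are \<open>v\<close>. Vectors of the model space at
  different points are thus unrelated, and every passage between points or charts is made with
  \<open>tangent_map\<close>.\<close>
definition chart_at :: "('m, 'e) atlas \<Rightarrow> 'm \<Rightarrow> ('m, 'e) chart" where
  "chart_at A p = (SOME c. c \<in> A \<and> p \<in> fst c)"

text \<open>\<open>tangent_map A B f p\<close> is \<open>T\<^sub>pf\<close>, from the tangent space at \<open>p\<close> to the tangent space at \<open>f p\<close>;
  \<open>f\<close> need only be smooth near \<open>p\<close>.\<close>
definition tangent_map ::
  "('m, 'e::real_normed_vector) atlas \<Rightarrow> ('n, 'f::real_normed_vector) atlas \<Rightarrow>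
   ('m \<Rightarrow> 'n) \<Rightarrow> 'm \<Rightarrow> 'e \<Rightarrow> 'f" where
  "tangent_map A B f p v =
     frechet_derivative (snd (chart_at B (f p)) \<circ> f \<circ> chart_inv (chart_at A p))
       (at (snd (chart_at A p) p)) v"

text \<open>Smooth one-forms with values in a fixed vector space. Smoothness is smoothness of the pullbacks
  along the inverses of the charts: \<open>tangent_map std_atlas A (chart_inv (U, \<phi>)) y v\<close> is the tangent
  vector at \<open>\<phi>\<^sup>-\<^sup>1(y)\<close> whose coordinates in the chart \<open>\<phi>\<close> are \<open>v\<close>.\<close>
definition one_form ::
  "('m, 'e::real_normed_vector) atlas \<Rightarrow> ('m \<Rightarrow> 'e \<Rightarrow> 'v::real_normed_vector) \<Rightarrow> bool" where
  "one_form A \<omega> \<longleftrightarrow>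
     (\<forall>p. linear (\<omega> p)) \<and>
     (\<forall>(U, \<phi>)\<in>A. \<forall>v. smooth_on (\<phi> ` U)
        (\<lambda>y. \<omega> (chart_inv (U, \<phi>) y) (tangent_map std_atlas A (chart_inv (U, \<phi>)) y v)))"


section \<open>Lie groups and homogeneous spaces\<close>

record ('g, 'e) smooth_group = "'g monoid" +
  charts :: "('g, 'e) atlas"

definition lie_group ::
  "('g::{t2_space, second_countable_topology}, 'e::{real_inner, banach}) smooth_group \<Rightarrow> bool" where
  "lie_group G \<longleftrightarrow>
     group G \<and> carrier G = UNIV \<and> smooth_manifold (charts G) \<and>
     smooth_map (prod_atlas (charts G) (charts G)) (charts G) (\<lambda>(a, b). a \<otimes>\<^bsub>G\<^esub> b) \<and>
     smooth_map (charts G) (charts G) (\<lambda>a. inv\<^bsub>G\<^esub> a)"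

text \<open>The Lie algebra of \<open>G\<close>, as a vector space, is the tangent space at \<open>\<one>\<^bsub>G\<^esub>\<close>. Matrix notation is
  read as follows: \<open>gX\<close> and \<open>Xg\<close> are the images of the tangent vector \<open>X\<close> under the tangent maps of
  the left and right translations by \<open>g\<close>, and \<open>g\<xi>g\<^sup>-\<^sup>1\<close> for \<open>\<xi>\<close> in the Lie algebra is the image
  under the tangent map of conjugation by \<open>g\<close>. In the first two, the second group element is the
  base point of \<open>X\<close>.\<close>
definition left_mul :: "('g, 'e::real_normed_vector) smooth_group \<Rightarrow> 'g \<Rightarrow> 'g \<Rightarrow> 'e \<Rightarrow> 'e" where
  "left_mul G g a X = tangent_map (charts G) (charts G) (\<lambda>b. g \<otimes>\<^bsub>G\<^esub> b) a X"

definition right_mul :: "('g, 'e::real_normed_vector) smooth_group \<Rightarrow> 'g \<Rightarrow> 'g \<Rightarrow> 'e \<Rightarrow> 'e" where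
  "right_mul G g a X = tangent_map (charts G) (charts G) (\<lambda>b. b \<otimes>\<^bsub>G\<^esub> g) a X"

definition Ad :: "('g, 'e::real_normed_vector) smooth_group \<Rightarrow> 'g \<Rightarrow> 'e \<Rightarrow> 'e" where
  "Ad G g \<xi> = tangent_map (charts G) (charts G) (\<lambda>b. g \<otimes>\<^bsub>G\<^esub> b \<otimes>\<^bsub>G\<^esub> inv\<^bsub>G\<^esub> g) \<one>\<^bsub>G\<^esub> \<xi>"

text \<open>The Lie algebra of a closed (hence embedded) subgroup \<open>H\<close> of \<open>G\<close> is the tangent space of \<open>H\<close>
  at the identity, as a subspace of the Lie algebra of \<open>G\<close>: the velocities of the smooth curves
  of \<open>G\<close> that run in \<open>H\<close> and pass through the identity.\<close>
definition lie_subalgebra ::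
  "('g::topological_space, 'e::real_normed_vector) smooth_group \<Rightarrow> 'g set \<Rightarrow> 'e set" where
  "lie_subalgebra G H =
     {tangent_map std_atlas (charts G) \<gamma> (0::real) 1 | \<gamma>.
        smooth_map std_atlas (charts G) \<gamma> \<and> \<gamma> 0 = \<one>\<^bsub>G\<^esub> \<and> range \<gamma> \<subseteq> H}"

text \<open>The isotropy group of a point \<open>p\<close> is the library's \<open>stabilizer G act p\<close>.\<close>
definition homogeneous_space ::
  "('g::{t2_space, second_countable_topology}, 'e::{real_inner, banach}) smooth_group \<Rightarrow>
   ('m::{t2_space, second_countable_topology}, 'f::{real_inner, banach}) atlas \<Rightarrow>
   ('g \<Rightarrow> 'm \<Rightarrow> 'm) \<Rightarrow> bool" where
  "homogeneous_space G A act \<longleftrightarrow>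
     lie_group G \<and> smooth_manifold A \<and> transitive_action G UNIV act \<and>
     smooth_map (prod_atlas (charts G) A) A (\<lambda>(g, x). act g x)"

definition inf_action ::
  "('g, 'e::real_normed_vector) smooth_group \<Rightarrow> ('m, 'f::real_normed_vector) atlas \<Rightarrow>
   ('g \<Rightarrow> 'm \<Rightarrow> 'm) \<Rightarrow> 'e \<Rightarrow> 'm \<Rightarrow> 'f" where
  "inf_action G A act \<xi> x = tangent_map (charts G) A (\<lambda>g. act g x) \<one>\<^bsub>G\<^esub> \<xi>"


section \<open>Connections\<close>

definition connection ::
  "('g, 'e::real_normed_vector) smooth_group \<Rightarrow> ('m, 'f::real_normed_vector) atlas \<Rightarrow>
   ('g \<Rightarrow> 'm \<Rightarrow> 'm) \<Rightarrow> ('m \<Rightarrow> 'f \<Rightarrow> 'e) \<Rightarrow> bool" where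
  "connection G A act \<omega> \<longleftrightarrow>
     one_form A \<omega> \<and>
     (\<forall>x f. inf_action G A act (\<omega> x f) x = f) \<and>
     (\<forall>g\<in>carrier G. \<forall>x f. \<omega> (act g x) (tangent_map A A (act g) x f) = Ad G g (\<omega> x f))"

definition principal_connection ::
  "('g::topological_space, 'e::real_normed_vector) smooth_group \<Rightarrow> 'g set \<Rightarrow>
   ('g \<Rightarrow> 'e \<Rightarrow> 'e) \<Rightarrow> bool" where
  "principal_connection G H \<theta> \<longleftrightarrow>
     one_form (charts G) \<theta> \<and>
     (\<forall>g\<in>carrier G. \<forall>X. \<theta> g X \<in> lie_subalgebra G H) \<and>
     (\<forall>h\<in>H. \<forall>g\<in>carrier G. \<forall>X.
        \<theta> (g \<otimes>\<^bsub>G\<^esub> h) (right_mul G h g X) = Ad G (inv\<^bsub>G\<^esub> h) (\<theta> g X)) \<and>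
     (\<forall>g\<in>carrier G. \<forall>\<xi>\<in>lie_subalgebra G H. \<theta> g (left_mul G g \<one>\<^bsub>G\<^esub> \<xi>) = \<xi>)"

definition invariant_form ::
  "('g, 'e::real_normed_vector) smooth_group \<Rightarrow> ('g \<Rightarrow> 'e \<Rightarrow> 'v) \<Rightarrow> bool" where
  "invariant_form G \<theta> \<longleftrightarrow>
     (\<forall>k\<in>carrier G. \<forall>g\<in>carrier G. \<forall>X. \<theta> (k \<otimes>\<^bsub>G\<^esub> g) (left_mul G k g X) = \<theta> g X)"

end

(* Write pi(a) = a.o, L = T_1 pi and P(xi) = xi - <omega, L xi>_o. Equivariance of omega turns the
   definition of theta into <theta, X>_g = P(g^-1 X), and since omega is a section of the
   infinitesimal action, L P = 0. Equivariance also makes P commute with Ad(h), h in H; hence all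
   claims except smoothness and vertical values are identities for the Maurer-Cartan form g^-1 X.

   That P takes values in the Lie algebra of H means that the kernel of L consists of velocities of
   curves in H. Instead of the exponential map this uses that omega makes pi a submersion: a smooth
   inverse function theorem yields curves in the fibre of pi over o in all directions of the
   kernel. The inverse function theorem of the library needs a Euclidean space of positive
   dimension and gives no smoothness of higher order, so it is proved here for inner product spaces
   spanned by a finite set, using frames {b} with x = sum (x.b) b in place of orthonormal bases. *)
theory Submission
  imports Defs
begin

section \<open>Frames of finite-dimensional inner product spaces\<close>

text \<open>These are Parseval frames. Only finiteness and the expansion are used, so no linear
  independence has to be tracked and dimension 0 is no special case. The obstacle behind the
  calculus is that \<open>Ck_on\<close> speaks of derivatives in fixed directions, whereas the chain
  rule produces directions that move with the point; a frame reduces these to finitely many fixed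
  ones. Inverses of derivatives are treated as pointwise solutions of linear equations with a
  uniform lower bound, so that no space of operators is needed. Curves in the isotropy group must be
  smooth on the whole real line, as \<open>lie_subalgebra\<close> demands, although the inverse
  function theorem is only local. The charts selected by \<open>chart_at\<close> may jump from point
  to point; smoothness of a form is therefore examined only after pulling it back to one fixed
  chart.\<close>

definition frame :: "'a::real_inner set \<Rightarrow> bool" where
  "frame B \<longleftrightarrow> finite B \<and> (\<forall>x. (\<Sum>b\<in>B. (x \<bullet> b) *\<^sub>R b) = x)"

text \<open>Gram-Schmidt. Keeping the frame inside \<open>span B\<close> makes its expansion
  \<open>P\<close> the orthogonal projection onto \<open>span B\<close>; a new generator adds its
  normalized residual, or nothing if it already lies in the span.\<close>

lemma frame_exists:
  fixes B :: "'a::real_inner set"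
  assumes "finite B" "span B = UNIV"
  shows "\<exists>C::'a set. frame C"
proof -
  have "\<exists>C. finite C \<and> C \<subseteq> span B \<and> (\<forall>x\<in>span B. (\<Sum>c\<in>C. (x \<bullet> c) *\<^sub>R c) = x)"
    using assms(1)
  proof (induction B)
    case empty
    show ?case by (rule exI[of _ "{}"]) simp
  next
    case (insert a B)
    then obtain C where C: "finite C" "C \<subseteq> span B" "\<And>x. x \<in> span B \<Longrightarrow> (\<Sum>c\<in>C. (x \<bullet> c) *\<^sub>R c) = x"
      by blast
    define P where "P x = (\<Sum>c\<in>C. (x \<bullet> c) *\<^sub>R c)" for x
    have Pspan: "P x \<in> span B" for x
      unfolding P_def using C(2) by (intro span_sum span_mul) auto
    have mono: "span B \<subseteq> span (insert a B)" by (rule span_mono) auto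
    show ?case
    proof (cases "P a = a")
      case True
      then have "span (insert a B) = span B"
        using Pspan[of a] by (simp add: span_redundant)
      then show ?thesis using C by auto
    next
      case False
      define u where "u = (1 / norm (a - P a)) *\<^sub>R (a - P a)"
      have sym: "P x \<bullet> y = x \<bullet> P y" for x y
        by (simp add: P_def inner_sum_left inner_sum_right inner_commute mult.commute)
      have fixc: "P x = x" if "x \<in> span B" for x
        using C(3)[OF that] by (simp add: P_def)
      \<comment> \<open>\<open>P\<close> is self-adjoint and fixes \<open>x\<close>, so
        \<open>a\<close> and \<open>P a\<close> have the same inner product with
        \<open>x\<close>.\<close>
      have orth: "x \<bullet> u = 0" if "x \<in> span B" for x
        using sym[of a x] fixc[OF that]
        by (simp add: u_def inner_diff_right inner_commute)
      have uu: "u \<bullet> u = 1"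
        using False by (simp add: u_def dot_square_norm power2_eq_square)
      have uC: "u \<notin> C" using orth C(2) uu by force
      have sum': "(\<Sum>c\<in>insert u C. (x \<bullet> c) *\<^sub>R c) = (x \<bullet> u) *\<^sub>R u + P x" for x
        using C(1) uC by (simp add: P_def)
      have aeq: "a = norm (a - P a) *\<^sub>R u + P a"
        using False by (simp add: u_def)
      have Pu: "P u = 0"
        unfolding P_def using orth C(2) by (intro sum.neutral) (auto simp: inner_commute)
      have Plin: "P (x + y) = P x + P y" "P (k *\<^sub>R x) = k *\<^sub>R P x" for x y k
        by (simp_all add: P_def inner_add_left scaleR_add_left sum.distrib scaleR_sum_right)
      have "(\<Sum>c\<in>insert u C. (x \<bullet> c) *\<^sub>R c) = x" if "x \<in> span (insert a B)" for x
      proof -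
        obtain k where k: "x - k *\<^sub>R a \<in> span B"
          using \<open>x \<in> span (insert a B)\<close> span_breakdown_eq by blast
        \<comment> \<open>Since \<open>a\<close> is a multiple of \<open>u\<close> plus
          \<open>P a\<close>, the vector \<open>x\<close> becomes a multiple of \<open>u\<close>
          plus \<open>z\<close> in the old span, where \<open>P\<close> is the identity.\<close>
        define z where "z = (x - k *\<^sub>R a) + k *\<^sub>R P a"
        have z: "z \<in> span B" unfolding z_def by (intro span_add k span_mul Pspan)
        have x: "x = (k * norm (a - P a)) *\<^sub>R u + z"
        proof -
          have "(k * norm (a - P a)) *\<^sub>R u = k *\<^sub>R (norm (a - P a) *\<^sub>R u)" by simp
          also have "\<dots> = k *\<^sub>R (a - P a)" by (metis aeq add_diff_cancel_right')
          finally show ?thesis by (simp add: z_def algebra_simps)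
        qed
        show ?thesis
          unfolding sum' x
          by (simp add: Plin Pu fixc[OF z] inner_add_left orth[OF z] uu)
      qed
      moreover have "u \<in> span (insert a B)"
        unfolding u_def using Pspan[of a] mono
        by (intro span_mul span_diff) (auto intro: span_base)
      moreover have "C \<subseteq> span (insert a B)" using C(2) mono by auto
      ultimately show ?thesis using C(1) by (intro exI[of _ "insert u C"]) auto
    qed
  qed
  then show ?thesis using assms(2) by (auto simp: frame_def)
qed

lemma frame_linear_expansion:
  fixes B :: "'a::real_inner set" and f :: "'a \<Rightarrow> 'b::real_vector"
  assumes "frame B" "linear f"
  shows "f x = (\<Sum>b\<in>B. (x \<bullet> b) *\<^sub>R f b)"
proof -
  have "f x = f (\<Sum>b\<in>B. (x \<bullet> b) *\<^sub>R b)" using assms by (simp add: frame_def)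
  then show ?thesis using assms by (simp add: linear_sum linear_cmul)
qed

lemma frame_linear_bounded:
  fixes B :: "'a::real_inner set" and f :: "'a \<Rightarrow> 'b::real_normed_vector"
  assumes "frame B" "linear f"
  shows "bounded_linear f"
proof -
  have "bounded_linear (\<lambda>x. \<Sum>b\<in>B. (x \<bullet> b) *\<^sub>R f b)"
    by (rule bounded_linear_sum)
       (rule bounded_linear_scaleR_const[OF bounded_linear_inner_left])
  moreover have "(\<lambda>x. \<Sum>b\<in>B. (x \<bullet> b) *\<^sub>R f b) = f"
    by (rule ext) (rule frame_linear_expansion[OF assms, symmetric])
  ultimately show ?thesis by simp
qed

lemma frame_real: "frame {1::real}"
  by (simp add: frame_def)

lemma frame_prod:
  fixes B :: "'a::real_inner set" and C :: "'b::real_inner set"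
  assumes "frame B" "frame C"
  shows "\<exists>D::('a \<times> 'b) set. frame D"
proof -
  let ?f = "\<lambda>b. (b, 0::'b)" and ?g = "\<lambda>c. (0::'a, c)"
  have fin: "finite B" "finite C" using assms by (auto simp: frame_def)
  \<comment> \<open>The zero vector contributes nothing to an expansion; removing it makes the two
    embedded frames disjoint.\<close>
  have B: "(\<Sum>b\<in>B-{0}. (x \<bullet> b) *\<^sub>R b) = x" for x
    using assms(1) fin by (simp add: frame_def sum_diff1)
  have C: "(\<Sum>b\<in>C-{0}. (x \<bullet> b) *\<^sub>R b) = x" for x
    using assms(2) fin by (simp add: frame_def sum_diff1)
  have "(\<Sum>d\<in>?f ` (B-{0}) \<union> ?g ` (C-{0}). (p \<bullet> d) *\<^sub>R d) = p" for p :: "'a \<times> 'b"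
  proof -
    have "(\<Sum>d\<in>?f ` (B-{0}) \<union> ?g ` (C-{0}). (p \<bullet> d) *\<^sub>R d)
        = (\<Sum>b\<in>B-{0}. (fst p \<bullet> b) *\<^sub>R (b, 0)) + (\<Sum>c\<in>C-{0}. (snd p \<bullet> c) *\<^sub>R (0, c))"
      using fin
      by (subst sum.union_disjoint) (auto simp: sum.reindex inj_on_def inner_prod_def)
    also have "\<dots> = p"
      by (simp add: prod_eq_iff fst_sum snd_sum B C)
    finally show ?thesis .
  qed
  then show ?thesis
    using fin by (intro exI[of _ "?f ` (B-{0}) \<union> ?g ` (C-{0})"]) (auto simp: frame_def)
qed


section \<open>Calculus of functions of class C-k\<close>

lemma Ck_on_SucD:
  assumes "Ck_on (Suc k) S f"
  shows "\<And>x. x \<in> S \<Longrightarrow> (f has_derivative frechet_derivative f (at x)) (at x)"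
    and "\<And>v. Ck_on k S (\<lambda>x. frechet_derivative f (at x) v)"
  using assms frechet_derivative_works by auto

lemma Ck_on_subset: "Ck_on k S f \<Longrightarrow> T \<subseteq> S \<Longrightarrow> Ck_on k T f"
  by (induction k arbitrary: f) (auto intro: continuous_on_subset)

lemma Ck_on_cong:
  assumes "open S" "\<And>x. x \<in> S \<Longrightarrow> f x = g x" "Ck_on k S f"
  shows "Ck_on k S g"
  using assms(2,3)
proof (induction k arbitrary: f g)
  case 0
  then show ?case by (simp cong: continuous_on_cong)
next
  case (Suc k)
  have der: "(g has_derivative frechet_derivative f (at x)) (at x)" if "x \<in> S" for x
    using Ck_on_SucD(1)[OF Suc.prems(2) that] assms(1) that Suc.prems(1)
    by (rule has_derivative_transform_within_open)
  have "frechet_derivative f (at x) v = frechet_derivative g (at x) v" if "x \<in> S" for x v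
    using frechet_derivative_at[OF der[OF that]] by simp
  then have "Ck_on k S (\<lambda>x. frechet_derivative g (at x) v)" for v
    by (intro Suc.IH[OF _ Ck_on_SucD(2)[OF Suc.prems(2)]])
  then show ?case using der by (auto simp: differentiable_def)
qed

text \<open>The working form of the successor clause: a derivative given by a formula replaces the
  choice in \<open>frechet_derivative\<close>, with which it agrees on the open set.\<close>

lemma Ck_on_SucI:
  assumes "open S" "\<And>x. x \<in> S \<Longrightarrow> (f has_derivative f' x) (at x)"
    "\<And>v. Ck_on k S (\<lambda>x. f' x v)"
  shows "Ck_on (Suc k) S f"
proof -
  have "f' x v = frechet_derivative f (at x) v" if "x \<in> S" for x v
    using frechet_derivative_at[OF assms(2)[OF that]] by simp
  then have "Ck_on k S (\<lambda>x. frechet_derivative f (at x) v)" for v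
    by (intro Ck_on_cong[OF assms(1) _ assms(3)]) auto
  then show ?thesis using assms(2) by (auto simp: differentiable_def)
qed

lemma Ck_on_imp_continuous_on: "Ck_on k S f \<Longrightarrow> continuous_on S f"
  by (cases k) (simp_all add: continuous_at_imp_continuous_on differentiable_imp_continuous_within)

lemma Ck_on_Suc_imp: "Ck_on (Suc k) S f \<Longrightarrow> Ck_on k S f"
proof (induction k arbitrary: f)
  case 0
  then show ?case using Ck_on_imp_continuous_on Ck_on.simps(1) by blast
next
  case (Suc k)
  have "Ck_on k S (\<lambda>x. frechet_derivative f (at x) v)" for v
    by (rule Suc.IH[OF Ck_on_SucD(2)[OF Suc.prems]])
  then show ?case using Suc.prems by simp
qed

lemma Ck_on_local:
  assumes "\<And>x. x \<in> S \<Longrightarrow> \<exists>T. open T \<and> x \<in> T \<and> Ck_on k T f"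
  shows "Ck_on k S f"
  using assms
proof (induction k arbitrary: f)
  case 0
  have "continuous (at x) f" if "x \<in> S" for x
    using 0[OF that] by (metis Ck_on.simps(1) continuous_on_eq_continuous_at)
  then show ?case by (simp add: continuous_at_imp_continuous_on)
next
  case (Suc k)
  have "Ck_on k S (\<lambda>x. frechet_derivative f (at x) v)" for v
  proof (rule Suc.IH)
    fix x assume "x \<in> S"
    then obtain T where "open T" "x \<in> T" "Ck_on (Suc k) T f" using Suc.prems by blast
    then show "\<exists>T. open T \<and> x \<in> T \<and> Ck_on k T (\<lambda>x. frechet_derivative f (at x) v)"
      using Ck_on_SucD(2) by blast
  qed
  moreover have "f differentiable (at x)" if "x \<in> S" for x
    using Suc.prems[OF that] by auto
  ultimately show ?case by simp
qed

section \<open>Closure properties of the classes C-k\<close>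

lemma Ck_on_const: "Ck_on k S (\<lambda>x. c)"
  by (induction k arbitrary: c) auto

lemma Ck_on_bounded_linear:
  assumes "bounded_linear f"
  shows "Ck_on k S f"
proof (cases k)
  case 0
  then show ?thesis using assms linear_continuous_on by auto
next
  case (Suc n)
  have "(f has_derivative f) (at x)" for x
    by (rule bounded_linear_imp_has_derivative[OF assms])
  then have "Ck_on (Suc n) UNIV f"
    by (intro Ck_on_SucI[where f' = "\<lambda>_. f"] Ck_on_const) auto
  then show ?thesis using Suc Ck_on_subset by blast
qed

lemma Ck_on_linear_compose:
  assumes "open S" "bounded_linear L" "Ck_on k S f"
  shows "Ck_on k S (\<lambda>x. L (f x))"
  using assms(3)
proof (induction k arbitrary: f)
  case 0
  then show ?case using bounded_linear.continuous_on[OF assms(2)] by simp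
next
  case (Suc k)
  show ?case
    by (rule Ck_on_SucI[OF assms(1)], rule bounded_linear.has_derivative[OF assms(2)],
        rule Ck_on_SucD(1)[OF Suc.prems], assumption, rule Suc.IH, rule Ck_on_SucD(2)[OF Suc.prems])
qed

lemma Ck_on_add:
  assumes "open S" "Ck_on k S f" "Ck_on k S g"
  shows "Ck_on k S (\<lambda>x. f x + g x)"
  using assms(2,3)
proof (induction k arbitrary: f g)
  case 0
  then show ?case by (simp add: continuous_on_add)
next
  case (Suc k)
  show ?case
    by (rule Ck_on_SucI[OF assms(1)], rule has_derivative_add,
        rule Ck_on_SucD(1)[OF Suc.prems(1)], assumption, rule Ck_on_SucD(1)[OF Suc.prems(2)], assumption,
        rule Suc.IH, rule Ck_on_SucD(2)[OF Suc.prems(1)], rule Ck_on_SucD(2)[OF Suc.prems(2)])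
qed

lemma Ck_on_diff:
  assumes "open S" "Ck_on k S f" "Ck_on k S g"
  shows "Ck_on k S (\<lambda>x. f x - g x)"
  using Ck_on_add[OF assms(1,2) Ck_on_linear_compose[OF assms(1) bounded_linear_minus[OF bounded_linear_ident] assms(3)]]
  by simp

lemma Ck_on_sum:
  assumes "open S" "\<And>i. i \<in> I \<Longrightarrow> Ck_on k S (f i)"
  shows "Ck_on k S (\<lambda>x. \<Sum>i\<in>I. f i x)"
  using assms(2)
  by (induction I rule: infinite_finite_induct)
     (auto intro!: Ck_on_const Ck_on_add[OF assms(1)])

lemma Ck_on_scaleR:
  fixes f :: "'a::real_normed_vector \<Rightarrow> real"
  assumes "open S" "Ck_on k S f" "Ck_on k S g"
  shows "Ck_on k S (\<lambda>x. f x *\<^sub>R g x)"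
  using assms(2,3)
proof (induction k arbitrary: f g)
  case 0
  then show ?case by (simp add: continuous_on_scaleR)
next
  case (Suc k)
  show ?case
    by (rule Ck_on_SucI[OF assms(1)], rule has_derivative_scaleR,
        rule Ck_on_SucD(1)[OF Suc.prems(1)], assumption, rule Ck_on_SucD(1)[OF Suc.prems(2)], assumption,
        rule Ck_on_add[OF assms(1) Suc.IH[OF Ck_on_Suc_imp[OF Suc.prems(1)] Ck_on_SucD(2)[OF Suc.prems(2)]]
          Suc.IH[OF Ck_on_SucD(2)[OF Suc.prems(1)] Ck_on_Suc_imp[OF Suc.prems(2)]]])
qed

lemma Ck_on_Pair:
  assumes "open S" "Ck_on k S f" "Ck_on k S g"
  shows "Ck_on k S (\<lambda>x. (f x, g x))"
proof -
  have "Ck_on k S (\<lambda>x. (f x, 0) + (0, g x))"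
    by (intro Ck_on_add assms Ck_on_linear_compose[where L = "\<lambda>a. (a, 0)"]
        Ck_on_linear_compose[where L = "\<lambda>a. (0, a)"])
       (auto intro: bounded_linear_Pair bounded_linear_ident bounded_linear_zero)
  then show ?thesis by simp
qed

text \<open>Expanding \<open>w x\<close> in the frame turns an operator applied to a moving vector
  into a finite sum of products, whose factors are a scalar function and the operator at a fixed
  vector.\<close>

lemma Ck_on_frame_apply:
  fixes B :: "'b::real_inner set" and w :: "'a::real_normed_vector \<Rightarrow> 'b"
  assumes "open S" "frame B" "\<And>x. x \<in> S \<Longrightarrow> linear (M x)"
    "Ck_on k S w" "\<And>b. Ck_on k S (\<lambda>x. M x b)"
  shows "Ck_on k S (\<lambda>x. M x (w x))"
proof -
  have "Ck_on k S (\<lambda>x. \<Sum>b\<in>B. (w x \<bullet> b) *\<^sub>R M x b)"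
    by (intro Ck_on_sum Ck_on_scaleR Ck_on_linear_compose[OF _ bounded_linear_inner_left] assms)
  then show ?thesis
    by (rule Ck_on_cong[OF assms(1), rotated]) (rule frame_linear_expansion[OF assms(2,3), symmetric])
qed

text \<open>In the derivative of the composite, both the point \<open>f x\<close> and the direction
  depend on \<open>x\<close>. The induction hypothesis, for the derivatives of \<open>g\<close> in
  fixed directions, handles the point; a frame of the middle space handles the direction.\<close>

lemma Ck_on_compose:
  fixes B :: "'b::real_inner set" and f :: "'a::real_normed_vector \<Rightarrow> 'b"
  assumes "frame B" "open S" "open T" "f ` S \<subseteq> T" "Ck_on k S f" "Ck_on k T g"
  shows "Ck_on k S (\<lambda>x. g (f x))"
  using assms(5,6)
proof (induction k arbitrary: g)
  case 0
  then show ?case using continuous_on_compose2[of T g S f] assms(4) by simp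
next
  case (Suc k)
  have D: "(g has_derivative frechet_derivative g (at (f x))) (at (f x))" if "x \<in> S" for x
    using Ck_on_SucD(1)[OF Suc.prems(2)] that assms(4) by blast
  show ?case
  proof (rule Ck_on_SucI[OF assms(2)])
    show "((\<lambda>x. g (f x)) has_derivative
        (\<lambda>v. frechet_derivative g (at (f x)) (frechet_derivative f (at x) v))) (at x)" if "x \<in> S" for x
      using diff_chain_at[OF Ck_on_SucD(1)[OF Suc.prems(1) that] D[OF that]] by (simp add: o_def)
    show "Ck_on k S (\<lambda>x. frechet_derivative g (at (f x)) (frechet_derivative f (at x) v))" for v
    proof (rule Ck_on_frame_apply[OF assms(2,1), where M = "\<lambda>x. frechet_derivative g (at (f x))"
          and w = "\<lambda>x. frechet_derivative f (at x) v"])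
      show "linear (frechet_derivative g (at (f x)))" if "x \<in> S" for x
        using D[OF that] has_derivative_linear by blast
      show "Ck_on k S (\<lambda>x. frechet_derivative f (at x) v)"
        by (rule Ck_on_SucD(2)[OF Suc.prems(1)])
      show "Ck_on k S (\<lambda>x. frechet_derivative g (at (f x)) b)" for b
        by (rule Suc.IH[OF Ck_on_Suc_imp[OF Suc.prems(1)] Ck_on_SucD(2)[OF Suc.prems(2)]])
    qed
  qed
qed

text \<open>The sine later confines a line to a bounded segment without loss of smoothness. Both
  functions are treated together because each is, up to sign, the derivative of the other.\<close>

lemma Ck_on_sin_cos: "Ck_on k UNIV (sin :: real \<Rightarrow> real) \<and> Ck_on k UNIV (cos :: real \<Rightarrow> real)"
proof (induction k)
  case 0
  show ?case
    by (auto intro!: continuous_at_imp_continuous_on intro: DERIV_isCont[OF DERIV_sin] DERIV_isCont[OF DERIV_cos])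
next
  case (Suc k)
  have "Ck_on (Suc k) UNIV (sin :: real \<Rightarrow> real)"
  proof (rule Ck_on_SucI)
    show "(sin has_derivative (\<lambda>v. v *\<^sub>R cos x)) (at x)" for x :: real
      by (rule has_derivative_eq_rhs[OF DERIV_sin[unfolded has_field_derivative_def]]) (simp add: fun_eq_iff)
    show "Ck_on k UNIV (\<lambda>x::real. v *\<^sub>R cos x)" for v :: real
      by (rule Ck_on_linear_compose[OF open_UNIV bounded_linear_scaleR_right conjunct2[OF Suc]])
  qed (rule open_UNIV)
  moreover have "Ck_on (Suc k) UNIV (cos :: real \<Rightarrow> real)"
  proof (rule Ck_on_SucI)
    show "(cos has_derivative (\<lambda>v. (- v) *\<^sub>R sin x)) (at x)" for x :: real
      by (rule has_derivative_eq_rhs[OF DERIV_cos[unfolded has_field_derivative_def]]) (simp add: fun_eq_iff)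
    show "Ck_on k UNIV (\<lambda>x::real. (- v) *\<^sub>R sin x)" for v :: real
      by (rule Ck_on_linear_compose[OF open_UNIV bounded_linear_scaleR_right conjunct1[OF Suc]])
  qed (rule open_UNIV)
  ultimately show ?case by (rule conjI)
qed


section \<open>The smooth inverse function theorem\<close>

text \<open>A product rule for a factor \<open>f\<close> that is merely continuous: the term with
  the derivative of \<open>f\<close> would be multiplied by \<open>g x = 0\<close>. It lets the
  solution of a linear equation be differentiated when only its continuity is known.\<close>

lemma has_derivative_scaleR_zero:
  fixes f :: "'a::real_normed_vector \<Rightarrow> real" and g :: "'a \<Rightarrow> 'b::real_normed_vector"
  assumes f: "continuous (at x) f" and g: "(g has_derivative g') (at x)" and g0: "g x = 0"
  shows "((\<lambda>z. f z *\<^sub>R g z) has_derivative (\<lambda>v. f x *\<^sub>R g' v)) (at x)"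
proof -
  have g': "bounded_linear g'" and
    r: "((\<lambda>z. norm (g z - g x - g' (z - x)) / norm (z - x)) \<longlongrightarrow> 0) (at x)"
    using g by (auto simp: has_derivative_iff_norm)
  obtain K where K: "\<And>v. norm (g' v) \<le> norm v * K"
    using bounded_linear.bounded[OF g'] by blast
  \<comment> \<open>Splitting \<open>f z\<close> into \<open>f x\<close> and
    \<open>f z - f x\<close> leaves this remainder: \<open>g z\<close> is at most of the order of
    \<open>norm (z - x)\<close>, and its factor tends to 0.\<close>
  have "((\<lambda>z. (f z - f x) *\<^sub>R g z) has_derivative (\<lambda>v. 0)) (at x)"
    unfolding has_derivative_iff_norm
  proof (intro conjI bounded_linear_zero)
    let ?r = "\<lambda>z. norm (g z - g x - g' (z - x)) / norm (z - x)"
    have bound: "norm ((f z - f x) *\<^sub>R g z - (f x - f x) *\<^sub>R g x - 0) / norm (z - x)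
        \<le> \<bar>f z - f x\<bar> * (?r z + K)" if "z \<noteq> x" for z
    proof -
      have "norm (g z) \<le> norm (g z - g' (z - x)) + norm (g' (z - x))"
        using norm_triangle_ineq[of "g z - g' (z - x)" "g' (z - x)"] by simp
      also have "\<dots> \<le> norm (g z - g' (z - x)) + norm (z - x) * K"
        using K by simp
      finally have "norm (g z) / norm (z - x) \<le> ?r z + K"
        using that g0 by (simp add: field_simps)
      then have "\<bar>f z - f x\<bar> * (norm (g z) / norm (z - x)) \<le> \<bar>f z - f x\<bar> * (?r z + K)"
        by (intro mult_left_mono) auto
      then show ?thesis by simp
    qed
    have "((\<lambda>z. \<bar>f z - f x\<bar> * (?r z + K)) \<longlongrightarrow> \<bar>f x - f x\<bar> * (0 + K)) (at x)"
      using f r unfolding continuous_at by (intro tendsto_intros) auto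
    then have lim: "((\<lambda>z. \<bar>f z - f x\<bar> * (?r z + K)) \<longlongrightarrow> 0) (at x)" by simp
    show "((\<lambda>z. norm ((f z - f x) *\<^sub>R g z - (f x - f x) *\<^sub>R g x - 0) / norm (z - x)) \<longlongrightarrow> 0) (at x)"
      by (rule tendsto_sandwich[OF _ _ tendsto_const lim])
         (auto simp: eventually_at_filter intro!: always_eventually bound[simplified])
  qed
  from has_derivative_add[OF this bounded_linear.has_derivative[OF bounded_linear_scaleR_right g, of "f x"]]
  show ?thesis by (simp add: scaleR_left_diff_distrib)
qed

text \<open>The lower bound makes \<open>M\<close> injective, so a right inverse, given merely as a
  function, is the inverse. Injectivity also forces its linearity, and the lower bound at
  \<open>J x\<close> is its boundedness.\<close>

lemma right_inverse_bounded_linear: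
  fixes M :: "'a::real_normed_vector \<Rightarrow> 'b::real_normed_vector"
  assumes M: "linear M" and lower: "\<And>v. norm v \<le> K * norm (M v)" and MJ: "\<And>w. M (J w) = w"
  shows "bounded_linear J" and "J (M v) = v"
proof -
  have inj: "u = v" if "M u = M v" for u v
    using lower[of "u - v"] that by (simp add: linear_diff[OF M])
  show "J (M v) = v" by (rule inj) (rule MJ)
  show "bounded_linear J"
  proof (rule bounded_linear_intro[where K = K])
    show "J (x + y) = J x + J y" for x y by (rule inj) (simp add: MJ linear_add[OF M])
    show "J (r *\<^sub>R x) = r *\<^sub>R J x" for r x by (rule inj) (simp add: MJ linear_cmul[OF M])
    show "norm (J x) \<le> norm x * K" for x using lower[of "J x"] by (simp add: MJ mult.commute)
  qed
qed

text \<open>The solution \<open>y\<close> of \<open>M y = w\<close> has the derivative \<open>M\<^sup>-\<^sup>1(w' - M' y)\<close>, so that it gains a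
  derivative at every step of the induction.\<close>
lemma Ck_on_solve_linear:
  fixes B :: "'b::real_inner set" and M J :: "'a::real_normed_vector \<Rightarrow> 'b \<Rightarrow> 'b"
  assumes S: "open S" and B: "frame B"
    and M: "\<And>x. x \<in> S \<Longrightarrow> linear (M x)"
    and lower: "\<And>x v. x \<in> S \<Longrightarrow> norm v \<le> K * norm (M x v)"
    and MJ: "\<And>x w. x \<in> S \<Longrightarrow> M x (J x w) = w"
    and "\<And>v. Ck_on k S (\<lambda>x. M x v)" and "Ck_on k S w"
  shows "Ck_on k S (\<lambda>x. J x (w x))"
  using assms(6,7)
proof (induction k arbitrary: w)
  case 0
  have "continuous (at x) (\<lambda>x. J x (w x))" if x: "x \<in> S" for x
  proof -
    let ?y = "J x (w x)"
    have cont: "continuous (at x) w" "continuous (at x) (\<lambda>z. M z ?y)"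
      using 0 x S by (simp_all add: continuous_on_eq_continuous_at)
    have "((\<lambda>z. K * norm (w z - M z ?y)) \<longlongrightarrow> K * norm (w x - M x ?y)) (at x)"
      using cont unfolding continuous_at by (intro tendsto_intros)
    then have lim: "((\<lambda>z. K * norm (w z - M z ?y)) \<longlongrightarrow> 0) (at x)" by (simp add: MJ[OF x])
    \<comment> \<open>\<open>M z\<close> sends this difference to \<open>w z - M z ?y\<close>, which
      tends to 0 as \<open>z\<close> approaches \<open>x\<close>; the uniform constant
      \<open>K\<close> carries this back.\<close>
    have "norm (J z (w z) - ?y) \<le> K * norm (w z - M z ?y)" if "z \<in> S" for z
      using lower[OF that, of "J z (w z) - ?y"] by (simp add: linear_diff[OF M[OF that]] MJ[OF that])
    then have "eventually (\<lambda>z. norm (J z (w z) - ?y) \<le> K * norm (w z - M z ?y)) (at x)"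
      using S x by (auto simp: eventually_at_topological)
    from Lim_null_comparison[OF this lim] show ?thesis
      unfolding continuous_at using Lim_null by blast
  qed
  then show ?case by (simp add: continuous_at_imp_continuous_on)
next
  case (Suc k)
  note w = Ck_on_Suc_imp[OF Suc.prems(2)] and Mk = Ck_on_Suc_imp[OF Suc.prems(1)]
  let ?D = "\<lambda>f x. frechet_derivative f (at x)"
  define y where "y x = J x (w x)" for x
  have y: "Ck_on k S y"
    unfolding y_def by (rule Suc.IH[OF Mk w])
  have ycont: "continuous (at x) y" if "x \<in> S" for x
    using Ck_on_imp_continuous_on[OF y] S that by (simp add: continuous_on_eq_continuous_at)
  \<comment> \<open>This is w' - M' y; the second term is expanded in the frame because only the
    columns \<open>M x b\<close> are known to be differentiable.\<close>
  define d where "d x v = ?D w x v - (\<Sum>b\<in>B. (y x \<bullet> b) *\<^sub>R ?D (\<lambda>z. M z b) x v)" for x v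
  have der: "(y has_derivative (\<lambda>v. J x (d x v))) (at x)" if x: "x \<in> S" for x
  proof -
    note J = right_inverse_bounded_linear[OF M[OF x] lower[OF x] MJ[OF x]]
    \<comment> \<open>The idea is to write \<open>M x (y z)\<close> as \<open>w z\<close> minus
      \<open>(M z - M x)\<close> applied to \<open>y z\<close>. The coefficients of
      \<open>y z\<close> vanish at \<open>z = x\<close>, so continuity of \<open>y\<close> is enough
      to differentiate.\<close>
    have "((\<lambda>z. (y z \<bullet> b) *\<^sub>R (M z b - M x b)) has_derivative
        (\<lambda>v. (y x \<bullet> b) *\<^sub>R (?D (\<lambda>z. M z b) x v - 0))) (at x)" for b
      by (intro has_derivative_scaleR_zero has_derivative_diff has_derivative_const
          Ck_on_SucD(1)[OF Suc.prems(1) x] continuous_inner ycont[OF x] continuous_const) simp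
    then have "((\<lambda>z. \<Sum>b\<in>B. (y z \<bullet> b) *\<^sub>R (M z b - M x b)) has_derivative
        (\<lambda>v. \<Sum>b\<in>B. (y x \<bullet> b) *\<^sub>R ?D (\<lambda>z. M z b) x v)) (at x)"
      by (intro has_derivative_sum) simp
    then have "((\<lambda>z. w z - (\<Sum>b\<in>B. (y z \<bullet> b) *\<^sub>R (M z b - M x b))) has_derivative d x) (at x)"
      unfolding d_def by (intro has_derivative_diff Ck_on_SucD(1)[OF Suc.prems(2) x])
    then have "((\<lambda>z. M x (y z)) has_derivative d x) (at x)"
    proof (rule has_derivative_transform_within_open[OF _ S x])
      fix z assume z: "z \<in> S"
      have "(\<Sum>b\<in>B. (y z \<bullet> b) *\<^sub>R (M z b - M x b)) = M z (y z) - M x (y z)"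
        by (simp add: frame_linear_expansion[OF B M[OF z], of "y z"]
            frame_linear_expansion[OF B M[OF x], of "y z"] sum_subtractf scaleR_diff_right)
      then show "w z - (\<Sum>b\<in>B. (y z \<bullet> b) *\<^sub>R (M z b - M x b)) = M x (y z)"
        by (simp add: y_def MJ[OF z])
    qed
    from bounded_linear.has_derivative[OF J(1) this] show ?thesis by (simp add: J(2))
  qed
  \<comment> \<open>The derivative of the solution solves the same system with right-hand side
    \<open>d x v\<close>, which is C-k because \<open>y\<close> already is; hence the induction is
    over arbitrary right-hand sides.\<close>
  have "Ck_on k S (\<lambda>x. J x (d x v))" for v
  proof (rule Suc.IH[OF Mk])
    show "Ck_on k S (\<lambda>x. d x v)"
      unfolding d_def
      by (intro Ck_on_diff Ck_on_sum Ck_on_scaleR S Ck_on_SucD(2)[OF Suc.prems(1)]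
          Ck_on_SucD(2)[OF Suc.prems(2)] Ck_on_linear_compose[OF _ bounded_linear_inner_left y])
  qed
  from Ck_on_SucI[OF S der this] show ?case by (simp add: y_def[abs_def])
qed

text \<open>Near \<open>a\<close> the map differs from the identity by a contraction, so Banach's
  fixed point theorem inverts it. Smoothness is a bootstrap: the derivative of the inverse solves a
  linear system with coefficients \<open>D (\<Psi> y)\<close>, which are C-k as soon as
  \<open>\<Psi>\<close> is.\<close>

theorem smooth_local_inverse:
  fixes B :: "'a::{real_inner, banach} set" and \<Phi> :: "'a \<Rightarrow> 'a"
  assumes B: "frame B" and U: "open U" "a \<in> U" and smooth: "smooth_on U \<Phi>"
    and der_a: "(\<Phi> has_derivative (\<lambda>v. v)) (at a)"
  obtains \<Psi> e where "e > 0" "smooth_on (ball (\<Phi> a) e) \<Psi>" "\<Psi> (\<Phi> a) = a"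
    "\<And>y. y \<in> ball (\<Phi> a) e \<Longrightarrow> \<Psi> y \<in> U \<and> \<Phi> (\<Psi> y) = y"
proof -
  have Ck: "Ck_on k U \<Phi>" for k using smooth by (simp add: smooth_on_def)
  define D where "D x = frechet_derivative \<Phi> (at x)" for x
  have der: "(\<Phi> has_derivative D x) (at x)" if "x \<in> U" for x
    unfolding D_def by (rule Ck_on_SucD(1)[OF Ck that])
  have DCk: "Ck_on k U (\<lambda>x. D x v)" for k v
    unfolding D_def by (rule Ck_on_SucD(2)[OF Ck])
  have Da: "D a = (\<lambda>v. v)" using has_derivative_unique[OF der[OF U(2)] der_a] .
  have Dlin: "linear (D x)" if "x \<in> U" for x using der[OF that] by (rule has_derivative_linear)
  \<comment> \<open>A majorant of the operator norm of \<open>D x\<close> minus the identity; being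
    a finite sum over columns it is continuous, and it vanishes at \<open>a\<close>.\<close>
  define N where "N x = (\<Sum>b\<in>B. norm b * norm (D x b - b))" for x
  have N: "norm (D x v - v) \<le> N x * norm v" if "x \<in> U" for x v
  proof -
    have "D x v - v = (\<Sum>b\<in>B. (v \<bullet> b) *\<^sub>R (D x b - b))"
      using frame_linear_expansion[OF B Dlin[OF that], of v]
        frame_linear_expansion[OF B linear_ident, of v]
      by (simp add: scaleR_diff_right sum_subtractf)
    also have "norm \<dots> \<le> (\<Sum>b\<in>B. (norm v * norm b) * norm (D x b - b))"
      by (rule order_trans[OF norm_sum]) (auto intro!: sum_mono mult_right_mono Cauchy_Schwarz_ineq2)
    finally show ?thesis by (simp add: N_def sum_distrib_left sum_distrib_right mult_ac)
  qed
  have "continuous (at a) N"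
    unfolding N_def
    using Ck_on_imp_continuous_on[OF DCk] U
    by (intro continuous_intros) (auto simp: continuous_on_eq_continuous_at)
  moreover have "N a = 0" by (simp add: N_def Da)
  ultimately have "(N \<longlongrightarrow> 0) (nhds a)"
    by (metis isCont_def tendsto_at_iff_tendsto_nhds)
  then have "eventually (\<lambda>x. N x < 1/2) (nhds a)"
    by (rule order_tendstoD) simp
  then obtain V where V: "open V" "a \<in> V" "\<And>x. x \<in> V \<Longrightarrow> N x < 1/2"
    by (auto simp: eventually_nhds)
  obtain r where r: "r > 0" "cball a r \<subseteq> U \<inter> V"
    using open_contains_cball_eq[of "U \<inter> V"] U V by blast
  have half: "norm (D x v - v) \<le> 1/2 * norm v" if "x \<in> cball a r" for x v
  proof -
    have "N x * norm v \<le> 1/2 * norm v"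
      using V(3)[of x] r(2) that by (intro mult_right_mono) auto
    then show ?thesis using N[of x v] r(2) that by auto
  qed
  have lip: "norm ((\<Phi> x - x) - (\<Phi> x' - x')) \<le> 1/2 * norm (x - x')"
    if "x \<in> cball a r" "x' \<in> cball a r" for x x'
  proof (rule differentiable_bound[where S = "cball a r" and f' = "\<lambda>x v. D x v - v"])
    show "((\<lambda>x. \<Phi> x - x) has_derivative (\<lambda>v. D z v - v)) (at z within cball a r)"
      if "z \<in> cball a r" for z
      using that r(2)
      by (intro has_derivative_diff has_derivative_ident has_derivative_at_withinI[OF der]) auto
    show "onorm (\<lambda>v. D z v - v) \<le> 1/2" if "z \<in> cball a r" for z
      by (rule onorm_bound[OF _ half[OF that]]) simp
  qed (use that in auto)
  \<comment> \<open>The contraction absorbs half of \<open>norm (x - x')\<close>, which leaves the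
    factor 2. This yields uniqueness of preimages in the ball and the Lipschitz constant of the
    inverse.\<close>
  have expand: "norm (x - x') \<le> 2 * norm (\<Phi> x - \<Phi> x')"
    if "x \<in> cball a r" "x' \<in> cball a r" for x x'
    using lip[OF that] norm_triangle_ineq4[of "\<Phi> x - \<Phi> x'" "(\<Phi> x - x) - (\<Phi> x' - x')"]
    by (simp add: algebra_simps)
  have aU: "a \<in> cball a r" using r(1) by simp
  have "\<exists>x\<in>cball a r. \<Phi> x = y" if y: "y \<in> ball (\<Phi> a) (r/2)" for y
  proof -
    \<comment> \<open>A fixed point is a solution of \<open>\<Phi> x = y\<close>. The iteration
      stays in the ball since the contraction contributes at most \<open>r/2\<close> and the
      distance from \<open>y\<close> to \<open>\<Phi> a\<close> less than
      \<open>r/2\<close>.\<close>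
    have "\<exists>!x\<in>cball a r. x - \<Phi> x + y = x"
    proof (rule Banach_fix[where c = "1/2"])
      show "complete (cball a r)" by (simp add: complete_eq_closed)
      show "(\<lambda>x. x - \<Phi> x + y) ` cball a r \<subseteq> cball a r"
      proof safe
        fix x assume x: "x \<in> cball a r"
        have "a - (x - \<Phi> x + y) = ((\<Phi> x - x) - (\<Phi> a - a)) + (\<Phi> a - y)" by simp
        then have "norm (a - (x - \<Phi> x + y)) \<le> norm ((\<Phi> x - x) - (\<Phi> a - a)) + norm (\<Phi> a - y)"
          using norm_triangle_ineq by metis
        also have "\<dots> \<le> 1/2 * r + r/2"
          using lip[OF x aU] x y by (auto simp: dist_norm norm_minus_commute)
        finally show "x - \<Phi> x + y \<in> cball a r" by (simp add: dist_norm)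
      qed
      show "dist (x - \<Phi> x + y) (x' - \<Phi> x' + y) \<le> 1/2 * dist x x'"
        if "x \<in> cball a r" "x' \<in> cball a r" for x x'
        using lip[OF that] norm_minus_commute[of "x - \<Phi> x" "x' - \<Phi> x'"]
        by (simp add: dist_norm algebra_simps)
    qed (use r in auto)
    then obtain x where x: "x \<in> cball a r" "x - \<Phi> x + y = x" by blast
    have "\<Phi> x - y = x - (x - \<Phi> x + y)" by simp
    also have "\<dots> = 0" by (simp only: x(2) diff_self)
    finally show ?thesis using x(1) by (intro bexI[of _ x]) simp_all
  qed
  then obtain \<Psi> where \<Psi>: "\<And>y. y \<in> ball (\<Phi> a) (r/2) \<Longrightarrow> \<Psi> y \<in> cball a r \<and> \<Phi> (\<Psi> y) = y"
    by metis
  let ?W = "ball (\<Phi> a) (r/2)"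
  have \<Psi>U: "\<Psi> y \<in> U" if "y \<in> ?W" for y using \<Psi>[OF that] r(2) by auto
  have \<Psi>a: "\<Psi> (\<Phi> a) = a"
    using expand[of "\<Psi> (\<Phi> a)" a] \<Psi>[of "\<Phi> a"] aU r(1) by simp
  have lip\<Psi>: "dist (\<Psi> y) (\<Psi> y') \<le> 2 * dist y y'" if "y \<in> ?W" "y' \<in> ?W" for y y'
    using expand[of "\<Psi> y" "\<Psi> y'"] \<Psi> that by (simp add: dist_norm)
  then have cont: "continuous_on ?W \<Psi>"
    by (intro lipschitz_on_continuous_on[where L = 2] lipschitz_onI) auto
  have lower: "norm v \<le> 2 * norm (D x v)" if "x \<in> cball a r" for x v
    using half[OF that, of v] norm_triangle_ineq4[of "D x v" "D x v - v"] by simp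
  have "\<exists>v. D x v = w" if x: "x \<in> cball a r" for x w
  proof -
    have lin: "linear (D x)" using Dlin x r(2) by auto
    \<comment> \<open>The same iteration at the linear level shows that \<open>D x\<close> is
      onto.\<close>
    have "\<exists>!v. v - D x v + w = v"
    proof (rule banach_fix_type[where c = "1/2"], simp, simp, intro allI)
      fix v v' :: 'a
      show "dist (v - D x v + w) (v' - D x v' + w) \<le> 1/2 * dist v v'"
        using half[OF x, of "v - v'"] norm_minus_commute[of "v - D x v" "v' - D x v'"]
        by (simp add: dist_norm linear_diff[OF lin] algebra_simps)
    qed
    then obtain v where v: "v - D x v + w = v" by blast
    have "D x v - w = v - (v - D x v + w)" by simp
    also have "\<dots> = 0" by (simp only: v diff_self)
    finally show ?thesis by (intro exI[of _ v]) simp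
  qed
  then obtain J where J: "\<And>x w. x \<in> cball a r \<Longrightarrow> D x (J x w) = w" by metis
  have der\<Psi>: "(\<Psi> has_derivative J (\<Psi> y)) (at y)" if y: "y \<in> ?W" for y
  proof (rule has_derivative_inverse_basic[where g = \<Psi> and y = y, OF der[OF \<Psi>U[OF y]]])
    have x: "\<Psi> y \<in> cball a r" using \<Psi>[OF y] by simp
    note Jx = right_inverse_bounded_linear[OF Dlin[OF \<Psi>U[OF y]] lower[OF x] J[OF x]]
    show "bounded_linear (J (\<Psi> y))" by (rule Jx(1))
    show "J (\<Psi> y) \<circ> D (\<Psi> y) = id" by (simp add: fun_eq_iff Jx(2))
    show "continuous (at y) \<Psi>"
      using cont y open_ball continuous_on_eq_continuous_at by blast
    show "open ?W" by (rule open_ball)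
  qed (use y \<Psi> in auto)
  have "Ck_on k ?W \<Psi>" for k
  proof (induction k)
    case 0
    show ?case using cont by simp
  next
    case (Suc k)
    show ?case
    proof (rule Ck_on_SucI[OF open_ball der\<Psi>])
      show "Ck_on k ?W (\<lambda>y. J (\<Psi> y) v)" for v
      proof (rule Ck_on_solve_linear[OF open_ball B, where M = "\<lambda>y. D (\<Psi> y)" and J = "\<lambda>y. J (\<Psi> y)" and K = 2])
        show "Ck_on k ?W (\<lambda>y. D (\<Psi> y) u)" for u
          by (rule Ck_on_compose[OF B open_ball U(1) _ Suc DCk]) (use \<Psi>U in auto)
      qed (use \<Psi> \<Psi>U Dlin lower J Ck_on_const in auto)
    qed
  qed
  then have "smooth_on ?W \<Psi>" by (simp add: smooth_on_def)
  then show ?thesis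
    using that[of "r/2" \<Psi>] r(1) \<Psi>a \<Psi> \<Psi>U by auto
qed


section \<open>Smooth atlases\<close>

lemma smooth_map_iff:
  "smooth_map A B f \<longleftrightarrow> continuous_on UNIV f \<and>
     (\<forall>c\<in>A. \<forall>d\<in>B. smooth_on (snd c ` (fst c \<inter> f -` fst d)) (snd d \<circ> f \<circ> chart_inv c))"
  by (auto simp: smooth_map_def case_prod_unfold)

lemma smooth_mapD:
  assumes "smooth_map A B f"
  shows "continuous_on UNIV f" "isCont f x"
    "c \<in> A \<Longrightarrow> d \<in> B \<Longrightarrow> Ck_on k (snd c ` (fst c \<inter> f -` fst d)) (snd d \<circ> f \<circ> chart_inv c)"
  using assms by (auto simp: smooth_map_iff smooth_on_def continuous_on_eq_continuous_at)

text \<open>The notion of \<^const>\<open>smooth_manifold\<close> without countability; thus it also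
  applies to the model spaces with their standard atlas.\<close>
definition smooth_atlas :: "('m::t2_space, 'e::real_inner) atlas \<Rightarrow> bool" where
  "smooth_atlas A \<longleftrightarrow>
     (\<exists>B::'e set. frame B) \<and>
     (\<forall>p. \<exists>c\<in>A. p \<in> fst c) \<and>
     (\<forall>c\<in>A. open (fst c) \<and> open (snd c ` fst c) \<and> inj_on (snd c) (fst c) \<and>
        continuous_on (fst c) (snd c) \<and> continuous_on (snd c ` fst c) (chart_inv c)) \<and>
     smooth_map A A (\<lambda>x. x)"

lemma smooth_manifold_imp_smooth_atlas:
  fixes A :: "('m::{t2_space, second_countable_topology}, 'e::{real_inner, banach}) atlas"
  assumes "smooth_manifold A"
  shows "smooth_atlas A"
proof -
  have frame: "\<exists>B::'e set. finite B \<and> span B = UNIV"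
    and cover: "(\<Union>c\<in>A. fst c) = UNIV"
    and hom: "\<forall>c\<in>A. open (fst c) \<and> open (snd c ` fst c) \<and>
      (\<exists>\<psi>. homeomorphism (fst c) (snd c ` fst c) (snd c) \<psi>)"
    and trans: "\<forall>c\<in>A. \<forall>d\<in>A. smooth_on (snd c ` (fst c \<inter> fst d)) (snd d \<circ> chart_inv c)"
    using assms unfolding smooth_manifold_def case_prod_unfold prod.collapse
    by (rule conjunct1, rule conjunct1[OF conjunct2], rule conjunct1[OF conjunct2[OF conjunct2]],
        rule conjunct2[OF conjunct2[OF conjunct2]])
  have charts: "open (fst c) \<and> open (snd c ` fst c) \<and> inj_on (snd c) (fst c) \<and>
        continuous_on (fst c) (snd c) \<and> continuous_on (snd c ` fst c) (chart_inv c)" if "c \<in> A" for c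
  proof -
    note c = bspec[OF hom that]
    from conjunct2[OF conjunct2[OF c]]
    obtain \<psi> where h: "homeomorphism (fst c) (snd c ` fst c) (snd c) \<psi>" ..
    have inj: "inj_on (snd c) (fst c)"
      by (rule inj_on_inverseI) (rule homeomorphism_apply1[OF h])
    have "continuous_on (snd c ` fst c) \<psi>" by (rule homeomorphism_cont2[OF h])
    moreover have "\<psi> y = chart_inv c y" if "y \<in> snd c ` fst c" for y
      using that inj homeomorphism_apply1[OF h] by (auto simp: chart_inv_def)
    ultimately have "continuous_on (snd c ` fst c) (chart_inv c)"
      by (rule continuous_on_eq)
    then show ?thesis using c inj homeomorphism_cont1[OF h] by blast
  qed
  have "\<exists>B::'e set. frame B"
    using frame frame_exists by blast
  moreover have "\<forall>p. \<exists>c\<in>A. p \<in> fst c"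
    using cover by blast
  moreover have "smooth_map A A (\<lambda>x. x)"
    using trans continuous_on_id by (simp add: smooth_map_iff o_def)
  ultimately show ?thesis using charts by (simp add: smooth_atlas_def)
qed

lemma smooth_atlas_frame: "smooth_atlas (A :: ('m::t2_space, 'e::real_inner) atlas) \<Longrightarrow> \<exists>B::'e set. frame B"
  by (simp add: smooth_atlas_def)

lemma smooth_atlas_cover: "smooth_atlas A \<Longrightarrow> \<exists>c\<in>A. p \<in> fst c"
  by (simp add: smooth_atlas_def)

lemma smooth_map_ident: "smooth_atlas A \<Longrightarrow> smooth_map A A (\<lambda>x. x)"
  by (simp add: smooth_atlas_def)

lemma chart_at:
  assumes "smooth_atlas A"
  shows "chart_at A p \<in> A" "p \<in> fst (chart_at A p)"
proof -
  have "chart_at A p \<in> A \<and> p \<in> fst (chart_at A p)"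
    unfolding chart_at_def
    by (rule someI_ex) (use smooth_atlas_cover[OF assms, of p] in blast)
  then show "chart_at A p \<in> A" "p \<in> fst (chart_at A p)" by simp_all
qed

section \<open>Charts of a smooth atlas\<close>

context
  fixes A :: "('m::t2_space, 'e::real_inner) atlas" and c
  assumes A: "smooth_atlas A" and c: "c \<in> A"
begin

lemma chart_open: "open (fst c)"
  and chart_open_image: "open (snd c ` fst c)"
  and chart_inj: "inj_on (snd c) (fst c)"
  and chart_cont: "continuous_on (fst c) (snd c)"
  and chart_inv_cont: "continuous_on (snd c ` fst c) (chart_inv c)"
  using A c by (auto simp: smooth_atlas_def)

lemma chart_inv_chart: "p \<in> fst c \<Longrightarrow> chart_inv c (snd c p) = p"
  using chart_inj by (simp add: chart_inv_def)

lemma chart_chart_inv: "y \<in> snd c ` fst c \<Longrightarrow> snd c (chart_inv c y) = y"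
  by (simp add: chart_inv_def f_inv_into_f)

lemma chart_inv_in: "y \<in> snd c ` fst c \<Longrightarrow> chart_inv c y \<in> fst c"
  by (simp add: chart_inv_def inv_into_into)

lemma chart_inv_isCont: "y \<in> snd c ` fst c \<Longrightarrow> isCont (chart_inv c) y"
  using chart_inv_cont chart_open_image continuous_on_eq_continuous_at by blast

text \<open>Trading an image for a preimage under \<open>chart_inv c\<close> makes the openness of
  coordinate domains a matter of continuity.\<close>

lemma chart_image_eq: "snd c ` (fst c \<inter> T) = snd c ` fst c \<inter> chart_inv c -` T"
  using chart_inv_chart chart_chart_inv chart_inv_in by (force simp: image_iff)

lemma chart_image_open: "open T \<Longrightarrow> open (snd c ` (fst c \<inter> T))"
  unfolding chart_image_eq
  using continuous_open_preimage[OF chart_inv_cont chart_open_image] by blast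

end

lemma chart_domain_open:
  assumes "smooth_atlas A" "smooth_atlas B" "continuous_on UNIV f" "c \<in> A" "d \<in> B"
  shows "open (snd c ` (fst c \<inter> f -` fst d))"
  using assms chart_image_open chart_open by (metis continuous_on_open_vimage open_UNIV Int_UNIV_right)

text \<open>No single intermediate chart need contain the image of a chart domain. The claim is
  therefore checked around one point, on the part \<open>S\<close> of the coordinate domain that
  \<open>f\<close> sends into a chart \<open>d\<close> around the image point.\<close>

lemma smooth_map_compose:
  fixes B :: "('n::t2_space, 'f::real_inner) atlas"
  assumes A: "smooth_atlas A" and B: "smooth_atlas B" and C: "smooth_atlas C"
    and f: "smooth_map A B f" and g: "smooth_map B C g"
  shows "smooth_map A C (\<lambda>x. g (f x))"
  unfolding smooth_map_iff smooth_on_def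
proof (intro conjI ballI allI)
  show cgf: "continuous_on UNIV (\<lambda>x. g (f x))"
    using continuous_on_compose2[OF smooth_mapD(1)[OF g] smooth_mapD(1)[OF f]] by simp
  obtain F :: "'f set" where F: "frame F" using smooth_atlas_frame[OF B] by blast
  fix c e k assume c: "c \<in> A" and e: "e \<in> C"
  show "Ck_on k (snd c ` (fst c \<inter> (\<lambda>x. g (f x)) -` fst e)) (snd e \<circ> (\<lambda>x. g (f x)) \<circ> chart_inv c)"
  proof (rule Ck_on_local)
    fix y assume y: "y \<in> snd c ` (fst c \<inter> (\<lambda>x. g (f x)) -` fst e)"
    then obtain p where p: "y = snd c p" "p \<in> fst c" "g (f p) \<in> fst e" by auto
    obtain d where d: "d \<in> B" "f p \<in> fst d" using smooth_atlas_cover[OF B] by blast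
    define S where "S = snd c ` (fst c \<inter> f -` fst d) \<inter> snd c ` (fst c \<inter> (\<lambda>x. g (f x)) -` fst e)"
    define T where "T = snd d ` (fst d \<inter> g -` fst e)"
    have S: "open S"
      unfolding S_def
      by (intro open_Int chart_domain_open[OF A B smooth_mapD(1)[OF f] c d(1)] chart_domain_open[OF A C cgf c e])
    have T: "open T"
      unfolding T_def by (rule chart_domain_open[OF B C smooth_mapD(1)[OF g] d(1) e])
    have Sinv: "\<exists>q\<in>fst c. z = snd c q \<and> chart_inv c z = q \<and> f q \<in> fst d \<and> g (f q) \<in> fst e"
      if "z \<in> S" for z
    proof (intro bexI conjI)
      have "z \<in> snd c ` fst c \<inter> chart_inv c -` (f -` fst d) \<inter> chart_inv c -` ((\<lambda>x. g (f x)) -` fst e)"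
        using that unfolding S_def chart_image_eq[OF A c] by simp
      then show "z = snd c (chart_inv c z)" "f (chart_inv c z) \<in> fst d" "g (f (chart_inv c z)) \<in> fst e"
          "chart_inv c z \<in> fst c"
        using chart_chart_inv[OF A c] chart_inv_in[OF A c] by auto
    qed (rule refl)
    let ?f = "snd d \<circ> f \<circ> chart_inv c" and ?g = "snd e \<circ> g \<circ> chart_inv d"
    have "Ck_on k S (\<lambda>z. ?g (?f z))"
    proof (rule Ck_on_compose[OF F S T])
      show "?f ` S \<subseteq> T" unfolding T_def using Sinv by fastforce
      show "Ck_on k S ?f"
        by (rule Ck_on_subset[OF smooth_mapD(3)[OF f c d(1)]]) (simp add: S_def)
      show "Ck_on k T ?g"
        unfolding T_def by (rule smooth_mapD(3)[OF g d(1) e])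
    qed
    then have "Ck_on k S (snd e \<circ> (\<lambda>x. g (f x)) \<circ> chart_inv c)"
    proof (rule Ck_on_cong[OF S, rotated])
      fix z assume "z \<in> S"
      then obtain q where "chart_inv c z = q" "f q \<in> fst d" using Sinv by blast
      then show "?g (?f z) = (snd e \<circ> (\<lambda>x. g (f x)) \<circ> chart_inv c) z"
        using chart_inv_chart[OF B d(1)] by simp
    qed
    moreover have "y \<in> S" using p d by (auto simp: S_def)
    ultimately show "\<exists>T. open T \<and> y \<in> T \<and> Ck_on k T (snd e \<circ> (\<lambda>x. g (f x)) \<circ> chart_inv c)"
      using S by blast
  qed
qed

lemma smooth_map_const: "smooth_map A B (\<lambda>_. q)"
  by (simp add: smooth_map_iff smooth_on_def o_def Ck_on_const continuous_on_const)

section \<open>Products of smooth atlases\<close>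

lemma prod_atlas_iff:
  "e \<in> prod_atlas A B \<longleftrightarrow> (\<exists>c\<in>A. \<exists>d\<in>B. e = (fst c \<times> fst d, map_prod (snd c) (snd d)))"
  unfolding prod_atlas_def by (simp add: Bex_def split_paired_Ex) metis

lemma chart_inv_prod:
  assumes A: "smooth_atlas A" and B: "smooth_atlas B" and c: "c \<in> A" and d: "d \<in> B"
    and y: "y \<in> snd c ` fst c" and z: "z \<in> snd d ` fst d"
  shows "chart_inv (fst c \<times> fst d, map_prod (snd c) (snd d)) (y, z) = (chart_inv c y, chart_inv d z)"
proof -
  have "inj_on (map_prod (snd c) (snd d)) (fst c \<times> fst d)"
    using chart_inj[OF A c] chart_inj[OF B d] by (rule map_prod_inj_on)
  then show ?thesis
    unfolding chart_inv_def fst_conv snd_conv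
    by (rule inv_into_f_eq)
       (use chart_chart_inv[OF A c y] chart_chart_inv[OF B d z] chart_inv_in[OF A c y] chart_inv_in[OF B d z]
         in \<open>auto simp: chart_inv_def\<close>)
qed

lemma prod_chart_facts:
  assumes A: "smooth_atlas A" and B: "smooth_atlas B" and c: "c \<in> A" and d: "d \<in> B"
  defines "e \<equiv> (fst c \<times> fst d, map_prod (snd c) (snd d))"
  shows "open (fst e)" "open (snd e ` fst e)" "inj_on (snd e) (fst e)"
    "continuous_on (fst e) (snd e)" "continuous_on (snd e ` fst e) (chart_inv e)"
proof -
  have im: "snd e ` fst e = (snd c ` fst c) \<times> (snd d ` fst d)"
    unfolding e_def by (simp add: map_prod_image)
  show "open (fst e)" unfolding e_def by (simp add: open_Times chart_open[OF A c] chart_open[OF B d])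
  show "open (snd e ` fst e)"
    unfolding im by (intro open_Times chart_open_image[OF A c] chart_open_image[OF B d])
  show "inj_on (snd e) (fst e)"
    unfolding e_def using chart_inj[OF A c] chart_inj[OF B d] by (simp add: map_prod_inj_on)
  show "continuous_on (fst e) (snd e)"
    unfolding e_def map_prod_def case_prod_unfold
    by (auto intro!: continuous_intros continuous_on_compose2[OF chart_cont[OF A c]]
        continuous_on_compose2[OF chart_cont[OF B d]])
  have "continuous_on ((snd c ` fst c) \<times> (snd d ` fst d)) (\<lambda>p. (chart_inv c (fst p), chart_inv d (snd p)))"
    by (auto intro!: continuous_on_Pair continuous_on_compose2[OF chart_inv_cont[OF A c]] 
        continuous_on_compose2[OF chart_inv_cont[OF B d]] continuous_on_fst continuous_on_snd continuous_on_id)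
  moreover have "chart_inv e p = (chart_inv c (fst p), chart_inv d (snd p))"
    if "p \<in> (snd c ` fst c) \<times> (snd d ` fst d)" for p
    using chart_inv_prod[OF A B c d, of "fst p" "snd p"] that by (auto simp: e_def)
  ultimately show "continuous_on (snd e ` fst e) (chart_inv e)"
    unfolding im by (simp cong: continuous_on_cong)
qed

text \<open>The counterpart of \<open>chart_image_open\<close>, derived from the factors because it
  enters the proof that the product atlas is smooth.\<close>

lemma prod_chart_image_open:
  assumes A: "smooth_atlas A" and B: "smooth_atlas B" and c: "c \<in> A" and d: "d \<in> B" and T: "open T"
  shows "open (map_prod (snd c) (snd d) ` ((fst c \<times> fst d) \<inter> T))"
proof -
  let ?e = "(fst c \<times> fst d, map_prod (snd c) (snd d))"
  note e = prod_chart_facts[OF A B c d]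
  have "snd ?e ` (fst ?e \<inter> T) = snd ?e ` fst ?e \<inter> chart_inv ?e -` T"
    using e(3) unfolding chart_inv_def by (auto simp: inv_into_f_f simp del: fst_conv snd_conv)
  moreover have "open (snd ?e ` fst ?e \<inter> chart_inv ?e -` T)"
    by (rule continuous_open_preimage[OF e(5,2) T])
  ultimately show ?thesis by simp
qed

lemma smooth_map_fst:
  fixes A :: "('m::t2_space, 'e::real_inner) atlas" and B :: "('n::t2_space, 'f::real_inner) atlas"
  assumes A: "smooth_atlas A" and B: "smooth_atlas B"
  shows "smooth_map (prod_atlas A B) A fst"
  unfolding smooth_map_iff smooth_on_def
proof (intro conjI ballI allI)
  show "continuous_on UNIV (fst :: 'm \<times> 'n \<Rightarrow> 'm)" by (intro continuous_intros)
  obtain F :: "'e set" where F: "frame F" using smooth_atlas_frame[OF A] by blast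
  fix p a k assume "p \<in> prod_atlas A B" and a: "a \<in> A"
  then obtain c d where cd: "c \<in> A" "d \<in> B" and p: "p = (fst c \<times> fst d, map_prod (snd c) (snd d))"
    by (auto simp: prod_atlas_iff)
  let ?S = "snd p ` (fst p \<inter> fst -` fst a)" and ?T = "snd c ` (fst c \<inter> (\<lambda>x. x) -` fst a)"
  have S: "open ?S"
    unfolding p fst_conv snd_conv
    by (rule prod_chart_image_open[OF A B cd]) (metis chart_open[OF A a] open_vimage_fst)
  have T: "open ?T" by (rule chart_domain_open[OF A A _ cd(1) a]) (rule continuous_on_id)
  \<comment> \<open>In coordinates the projection is the linear \<open>fst\<close> followed by a
    transition map of \<open>A\<close>.\<close>
  have "Ck_on k ?S (\<lambda>y. (snd a \<circ> (\<lambda>x. x) \<circ> chart_inv c) (fst y))"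
    by (rule Ck_on_compose[OF F S T _ Ck_on_bounded_linear[OF bounded_linear_fst]
          smooth_mapD(3)[OF smooth_map_ident[OF A] cd(1) a]]) (auto simp: p)
  then show "Ck_on k ?S (snd a \<circ> fst \<circ> chart_inv p)"
    by (rule Ck_on_cong[OF S, rotated]) (auto simp: p chart_inv_prod[OF A B cd])
qed

lemma smooth_map_snd:
  fixes A :: "('m::t2_space, 'e::real_inner) atlas" and B :: "('n::t2_space, 'f::real_inner) atlas"
  assumes A: "smooth_atlas A" and B: "smooth_atlas B"
  shows "smooth_map (prod_atlas A B) B snd"
  unfolding smooth_map_iff smooth_on_def
proof (intro conjI ballI allI)
  show "continuous_on UNIV (snd :: 'm \<times> 'n \<Rightarrow> 'n)" by (intro continuous_intros)
  obtain F :: "'f set" where F: "frame F" using smooth_atlas_frame[OF B] by blast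
  fix p a k assume "p \<in> prod_atlas A B" and a: "a \<in> B"
  then obtain c d where cd: "c \<in> A" "d \<in> B" and p: "p = (fst c \<times> fst d, map_prod (snd c) (snd d))"
    by (auto simp: prod_atlas_iff)
  let ?S = "snd p ` (fst p \<inter> snd -` fst a)" and ?T = "snd d ` (fst d \<inter> (\<lambda>x. x) -` fst a)"
  have S: "open ?S"
    unfolding p fst_conv snd_conv
    by (rule prod_chart_image_open[OF A B cd]) (metis chart_open[OF B a] open_vimage_snd)
  have T: "open ?T" by (rule chart_domain_open[OF B B _ cd(2) a]) (rule continuous_on_id)
  have "Ck_on k ?S (\<lambda>y. (snd a \<circ> (\<lambda>x. x) \<circ> chart_inv d) (snd y))"
    by (rule Ck_on_compose[OF F S T _ Ck_on_bounded_linear[OF bounded_linear_snd]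
          smooth_mapD(3)[OF smooth_map_ident[OF B] cd(2) a]]) (auto simp: p)
  then show "Ck_on k ?S (snd a \<circ> snd \<circ> chart_inv p)"
    by (rule Ck_on_cong[OF S, rotated]) (auto simp: p chart_inv_prod[OF A B cd])
qed

text \<open>The openness of chart images is a separate premise because the lemma is used for the product
  atlas before that is known to be a smooth atlas.\<close>
lemma smooth_map_Pair:
  fixes P :: "('k::t2_space, 'p::real_normed_vector) atlas"
  assumes op: "\<And>p T. p \<in> P \<Longrightarrow> open T \<Longrightarrow> open (snd p ` (fst p \<inter> T))"
    and A: "smooth_atlas A" and B: "smooth_atlas B"
    and f: "smooth_map P A f" and g: "smooth_map P B g"
  shows "smooth_map P (prod_atlas A B) (\<lambda>x. (f x, g x))"
  unfolding smooth_map_iff smooth_on_def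
proof (intro conjI ballI allI)
  show cont: "continuous_on UNIV (\<lambda>x. (f x, g x))"
    by (intro continuous_on_Pair smooth_mapD(1)[OF f] smooth_mapD(1)[OF g])
  fix p e k assume p: "p \<in> P" and "e \<in> prod_atlas A B"
  then obtain c d where cd: "c \<in> A" "d \<in> B" and e: "e = (fst c \<times> fst d, map_prod (snd c) (snd d))"
    by (auto simp: prod_atlas_iff)
  let ?S = "snd p ` (fst p \<inter> (\<lambda>x. (f x, g x)) -` fst e)"
  have "open (fst e)" using prod_chart_facts(1)[OF A B cd] by (simp add: e)
  then have S: "open ?S"
    by (intro op[OF p]) (metis cont continuous_on_open_vimage open_UNIV Int_UNIV_right)
  have "Ck_on k ?S (\<lambda>y. ((snd c \<circ> f \<circ> chart_inv p) y, (snd d \<circ> g \<circ> chart_inv p) y))"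
    by (intro Ck_on_Pair S Ck_on_subset[OF smooth_mapD(3)[OF f p cd(1)]]
        Ck_on_subset[OF smooth_mapD(3)[OF g p cd(2)]]) (auto simp: e)
  then show "Ck_on k ?S (snd e \<circ> (\<lambda>x. (f x, g x)) \<circ> chart_inv p)"
    by (simp add: e o_def)
qed

lemma smooth_atlas_prod:
  fixes A :: "('m::t2_space, 'e::real_inner) atlas" and B :: "('n::t2_space, 'f::real_inner) atlas"
  assumes A: "smooth_atlas A" and B: "smooth_atlas B"
  shows "smooth_atlas (prod_atlas A B)"
  unfolding smooth_atlas_def
proof (intro conjI ballI allI)
  show "\<exists>D::('e \<times> 'f) set. frame D"
    using smooth_atlas_frame[OF A] smooth_atlas_frame[OF B] frame_prod by blast
  show "\<exists>c\<in>prod_atlas A B. p \<in> fst c" for p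
  proof -
    obtain c d where "c \<in> A" "fst p \<in> fst c" "d \<in> B" "snd p \<in> fst d"
      using smooth_atlas_cover[OF A] smooth_atlas_cover[OF B] by metis
    then show ?thesis
      by (intro bexI[of _ "(fst c \<times> fst d, map_prod (snd c) (snd d))"]) (auto simp: prod_atlas_iff mem_Times_iff)
  qed
  \<comment> \<open>The identity is the pairing of the two projections, so the transition maps of
    the product are smooth without being computed.\<close>
  have "smooth_map (prod_atlas A B) (prod_atlas A B) (\<lambda>x. (fst x, snd x))"
    by (rule smooth_map_Pair[OF _ A B smooth_map_fst[OF A B] smooth_map_snd[OF A B]])
       (use prod_chart_image_open[OF A B] in \<open>fastforce simp: prod_atlas_iff\<close>)
  then show "smooth_map (prod_atlas A B) (prod_atlas A B) (\<lambda>x. x)" by simp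
qed (auto simp only: prod_atlas_iff prod_chart_facts[OF A B])

section \<open>Model spaces with their standard atlas\<close>

lemma smooth_atlas_std:
  assumes "frame (B :: 'e::real_inner set)"
  shows "smooth_atlas (std_atlas :: ('e, 'e) atlas)"
proof -
  have "chart_inv (UNIV, id :: 'e \<Rightarrow> 'e) = id" by (simp add: chart_inv_def inv_id)
  moreover have "Ck_on k UNIV (\<lambda>x::'e. x)" for k by (rule Ck_on_bounded_linear[OF bounded_linear_ident])
  ultimately show ?thesis
    using assms by (auto simp: smooth_atlas_def std_atlas_def smooth_map_iff smooth_on_def o_def id_def)
qed

lemma chart_at_std: "chart_at std_atlas p = (UNIV, id)" and chart_inv_std: "chart_inv (UNIV, id) = id"
  by (auto simp: chart_at_def std_atlas_def chart_inv_def inv_id intro: some_equality)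


section \<open>The chain rule for tangent maps\<close>

text \<open>Pointwise, because \<open>chart_inv c\<close> is controlled only on the image of its
  chart. Continuity is included to keep \<open>f\<close> inside the selected chart near
  \<open>p\<close>; the coordinate expression alone, with its irrelevant values outside chart
  domains, does not ensure this.\<close>

definition tangent_diff ::
  "('m::t2_space, 'e::real_normed_vector) atlas \<Rightarrow> ('n::t2_space, 'f::real_normed_vector) atlas \<Rightarrow>
   ('m \<Rightarrow> 'n) \<Rightarrow> 'm \<Rightarrow> bool" where
  "tangent_diff A B f p \<longleftrightarrow> isCont f p \<and>
     (snd (chart_at B (f p)) \<circ> f \<circ> chart_inv (chart_at A p)) differentiable (at (snd (chart_at A p) p))"

lemma tangent_map_has_derivative:
  "tangent_diff A B f p \<Longrightarrow>
    ((snd (chart_at B (f p)) \<circ> f \<circ> chart_inv (chart_at A p)) has_derivative tangent_map A B f p)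
      (at (snd (chart_at A p) p))"
  unfolding tangent_diff_def tangent_map_def[abs_def] using frechet_derivative_works by blast

lemma tangent_map_eqI:
  assumes "((snd (chart_at B (f p)) \<circ> f \<circ> chart_inv (chart_at A p)) has_derivative D) (at (snd (chart_at A p) p))"
  shows "tangent_map A B f p v = D v"
  unfolding tangent_map_def using frechet_derivative_at[OF assms] by simp

lemma tangent_map_bounded_linear: "tangent_diff A B f p \<Longrightarrow> bounded_linear (tangent_map A B f p)"
  using tangent_map_has_derivative has_derivative_bounded_linear by blast

lemma smooth_map_tangent_diff:
  assumes A: "smooth_atlas A" and B: "smooth_atlas B" and f: "smooth_map A B f"
  shows "tangent_diff A B f p"
proof -
  have "Ck_on (Suc 0) (snd (chart_at A p) ` (fst (chart_at A p) \<inter> f -` fst (chart_at B (f p))))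
    (snd (chart_at B (f p)) \<circ> f \<circ> chart_inv (chart_at A p))"
    by (rule smooth_mapD(3)[OF f chart_at(1)[OF A] chart_at(1)[OF B]])
  then show ?thesis
    using smooth_mapD(2)[OF f] chart_at(2)[OF A] chart_at(2)[OF B]
    by (auto simp: tangent_diff_def)
qed

text \<open>Both factors use the chart selected at \<open>f p\<close>, so no transition map
  intervenes. The coordinate expressions compose only where \<open>f\<close> stays in that chart,
  which by continuity is the case near the base point.\<close>

lemma tangent_map_compose:
  assumes A: "smooth_atlas A" and B: "smooth_atlas B"
    and f: "tangent_diff A B f p" and g: "tangent_diff B C g (f p)"
  shows "tangent_map A C (\<lambda>x. g (f x)) p v = tangent_map B C g (f p) (tangent_map A B f p v)"
proof -
  let ?c = "chart_at A p" and ?d = "chart_at B (f p)" and ?e = "chart_at C (g (f p))"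
  let ?y = "snd ?c p" and ?F = "snd ?d \<circ> f \<circ> chart_inv ?c" and ?K = "snd ?e \<circ> g \<circ> chart_inv ?d"
  note c = chart_at[OF A, of p] and d = chart_at[OF B, of "f p"]
  have inv: "chart_inv ?c ?y = p" by (rule chart_inv_chart[OF A c])
  have Fy: "?F ?y = snd ?d (f p)" by (simp add: inv)
  have "(?K \<circ> ?F has_derivative tangent_map B C g (f p) \<circ> tangent_map A B f p) (at ?y)"
    using diff_chain_at[OF tangent_map_has_derivative[OF f]] tangent_map_has_derivative[OF g] Fy by metis
  moreover have "eventually (\<lambda>y. (?K \<circ> ?F) y = (snd ?e \<circ> (\<lambda>x. g (f x)) \<circ> chart_inv ?c) y) (at ?y)"
  proof -
    have "isCont (\<lambda>y. f (chart_inv ?c y)) ?y"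
      using f inv chart_inv_isCont[OF A c(1) imageI[OF c(2)]]
      by (intro isCont_o2[of _ "chart_inv ?c" f]) (auto simp: tangent_diff_def)
    then have "((\<lambda>y. f (chart_inv ?c y)) \<longlongrightarrow> f p) (at ?y)" by (simp add: isCont_def inv)
    then have "eventually (\<lambda>y. f (chart_inv ?c y) \<in> fst ?d) (at ?y)"
      using chart_open[OF B d(1)] d(2) by (rule topological_tendstoD)
    then show ?thesis
      by eventually_elim (simp add: chart_inv_chart[OF B d(1)])
  qed
  ultimately have D: "((snd ?e \<circ> (\<lambda>x. g (f x)) \<circ> chart_inv ?c) has_derivative
      tangent_map B C g (f p) \<circ> tangent_map A B f p) (at ?y)"
    by (rule has_derivative_transform_eventually) (simp_all add: inv chart_inv_chart[OF B d])
  show "tangent_map A C (\<lambda>x. g (f x)) p v = tangent_map B C g (f p) (tangent_map A B f p v)"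
    using tangent_map_eqI[where f = "\<lambda>x. g (f x)", OF D] by simp
qed

lemma tangent_map_ident:
  assumes A: "smooth_atlas A"
  shows "tangent_map A A (\<lambda>x. x) p v = v"
proof (rule tangent_map_eqI)
  let ?c = "chart_at A p"
  note c = chart_at[OF A, of p]
  show "(snd ?c \<circ> (\<lambda>x. x) \<circ> chart_inv ?c has_derivative (\<lambda>v. v)) (at (snd ?c p))"
    by (rule has_derivative_transform_within_open[OF has_derivative_ident chart_open_image[OF A c(1)]])
       (use c(2) chart_chart_inv[OF A c(1)] in auto)
qed

lemma tangent_map_const: "tangent_map A B (\<lambda>_. q) p v = 0"
  by (simp add: tangent_map_def o_def)

text \<open>In the selected chart, \<open>chart_inv c\<close> is a transition map of the
  atlas.\<close>

lemma tangent_diff_chart_inv: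
  assumes A: "smooth_atlas (A :: ('m::t2_space, 'e::real_inner) atlas)" and c: "c \<in> A"
    and y: "y \<in> snd c ` fst c"
  shows "tangent_diff std_atlas A (chart_inv c) y"
proof -
  let ?d = "chart_at A (chart_inv c y)"
  note d = chart_at[OF A, of "chart_inv c y"]
  have "Ck_on (Suc 0) (snd c ` (fst c \<inter> (\<lambda>x. x) -` fst ?d)) (snd ?d \<circ> (\<lambda>x. x) \<circ> chart_inv c)"
    by (rule smooth_mapD(3)[OF smooth_map_ident[OF A] c d(1)])
  moreover have "y \<in> snd c ` (fst c \<inter> (\<lambda>x. x) -` fst ?d)"
    using chart_image_eq[OF A c, of "fst ?d"] y d(2) by auto
  ultimately show ?thesis
    using chart_inv_isCont[OF A c y] by (auto simp: tangent_diff_def chart_at_std chart_inv_std o_def)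
qed


section \<open>Curves in the fibres of a submersion\<close>

text \<open>The hypothesis on \<open>R\<close> says that the differential \<open>L\<close> of \<open>f\<close> at \<open>p\<close> is onto. In charts,
  \<open>x - R (L x) + R (f x)\<close> is then a local diffeomorphism that \<open>L\<close> carries to \<open>f\<close>, so that its inverse
  maps the line in a direction \<open>\<xi>\<close> of the kernel of \<open>L\<close> into a fibre of \<open>f\<close>. The line is traversed as
  \<open>\<delta> sin (t / \<delta>)\<close> to stay within the domain of the inverse for all times.\<close>
lemma submersion_fibre_curve:
  fixes C :: "('g::t2_space, 'e::{real_inner, banach}) atlas" and A :: "('m::t2_space, 'f::real_inner) atlas"
  assumes C: "smooth_atlas C" and A: "smooth_atlas A" and f: "smooth_map C A f"
    and R: "bounded_linear R" "\<And>y. tangent_map C A f p (R y) = y"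
    and \<xi>: "tangent_map C A f p \<xi> = 0"
  obtains \<gamma> where "smooth_map std_atlas C \<gamma>" "\<gamma> (0::real) = p" "\<And>t. f (\<gamma> t) = f p"
    "tangent_map std_atlas C \<gamma> 0 1 = \<xi>"
proof -
  obtain B :: "'e set" where B: "frame B" using smooth_atlas_frame[OF C] by blast
  define c where "c = chart_at C p"
  define d where "d = chart_at A (f p)"
  have c: "c \<in> C" "p \<in> fst c" unfolding c_def by (rule chart_at[OF C])+
  have d: "d \<in> A" "f p \<in> fst d" unfolding d_def by (rule chart_at[OF A])+
  define U where "U = snd c ` (fst c \<inter> f -` fst d)"
  define a where "a = snd c p"
  define F where "F = snd d \<circ> f \<circ> chart_inv c"
  define L where "L = tangent_map C A f p"
  have td: "tangent_diff C A f p" by (rule smooth_map_tangent_diff[OF C A f])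
  have L: "bounded_linear L" unfolding L_def by (rule tangent_map_bounded_linear[OF td])
  have LR: "L (R y) = y" for y unfolding L_def by (rule R(2))
  have U: "open U" unfolding U_def by (rule chart_domain_open[OF C A smooth_mapD(1)[OF f] c(1) d(1)])
  have aU: "a \<in> U" using c d by (auto simp: U_def a_def)
  have Fk: "Ck_on k U F" for k unfolding U_def F_def by (rule smooth_mapD(3)[OF f c(1) d(1)])
  have Fder: "(F has_derivative L) (at a)"
    using tangent_map_has_derivative[OF td] by (simp add: F_def L_def a_def c_def d_def)
  have inv_a: "chart_inv c a = p" unfolding a_def by (rule chart_inv_chart[OF C c])
  define \<Phi> where "\<Phi> x = x - R (L x) + R (F x)" for x
  have \<Phi>k: "Ck_on k U \<Phi>" for k
    unfolding \<Phi>_def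
    by (intro Ck_on_add Ck_on_diff U Ck_on_linear_compose[OF U R(1) Fk] Ck_on_bounded_linear
        bounded_linear_ident bounded_linear_compose[OF R(1) L])
  have \<Phi>der: "(\<Phi> has_derivative (\<lambda>v. v)) (at a)"
  proof -
    have "(\<Phi> has_derivative (\<lambda>v. v - R (L v) + R (L v))) (at a)"
      unfolding \<Phi>_def
      by (intro has_derivative_add has_derivative_diff has_derivative_ident
          bounded_linear_imp_has_derivative[OF bounded_linear_compose[OF R(1) L]]
          bounded_linear.has_derivative[OF R(1) Fder])
    then show ?thesis by simp
  qed
  have "smooth_on U \<Phi>" using \<Phi>k by (simp add: smooth_on_def)
  from smooth_local_inverse[OF B U aU this \<Phi>der]
  obtain \<Psi> e where e: "e > 0" and \<Psi>s: "smooth_on (ball (\<Phi> a) e) \<Psi>" and \<Psi>a: "\<Psi> (\<Phi> a) = a"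
    and \<Psi>: "\<And>y. y \<in> ball (\<Phi> a) e \<Longrightarrow> \<Psi> y \<in> U \<and> \<Phi> (\<Psi> y) = y" by blast
  have \<Psi>k: "Ck_on k (ball (\<Phi> a) e) \<Psi>" for k using \<Psi>s by (simp add: smooth_on_def)
  have \<Psi>der: "(\<Psi> has_derivative (\<lambda>v. v)) (at (\<Phi> a))"
  proof (rule has_derivative_inverse_basic[where f = \<Phi> and f' = "\<lambda>v. v"])
    show "(\<Phi> has_derivative (\<lambda>v. v)) (at (\<Psi> (\<Phi> a)))" using \<Phi>der \<Psi>a by simp
    show "continuous (at (\<Phi> a)) \<Psi>"
      using Ck_on_imp_continuous_on[OF \<Psi>k] e centre_in_ball open_ball continuous_on_eq_continuous_at by blast
    show "open (ball (\<Phi> a) e)" by (rule open_ball)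
  qed (use e \<Psi> in \<open>auto simp: o_def id_def\<close>)
  \<comment> \<open>The summand 1 covers \<open>\<xi> = 0\<close> and makes
    \<open>\<delta> * norm \<xi>\<close> strictly smaller than \<open>e\<close>.\<close>
  define \<delta> where "\<delta> = e / (norm \<xi> + 1)"
  have \<delta>: "\<delta> > 0" unfolding \<delta>_def using e by (intro divide_pos_pos) (auto intro: add_nonneg_pos)
  have \<delta>e: "\<delta> * norm \<xi> < e"
  proof -
    have "\<delta> * norm \<xi> < \<delta> * (norm \<xi> + 1)" using \<delta> by simp
    also have "\<dots> = e" unfolding \<delta>_def using norm_ge_zero[of \<xi>] by (simp add: add_nonneg_eq_0_iff)
    finally show ?thesis .
  qed
  define l where "l t = \<Phi> a + (\<delta> * sin (t / \<delta>)) *\<^sub>R \<xi>" for t :: real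
  have lball: "l t \<in> ball (\<Phi> a) e" for t
  proof -
    have "\<bar>\<delta> * sin (t / \<delta>)\<bar> * norm \<xi> \<le> \<delta> * norm \<xi>"
      using \<delta> by (intro mult_right_mono) (auto simp: abs_mult)
    then show ?thesis using \<delta>e by (simp add: l_def dist_norm)
  qed
  have lk: "Ck_on k UNIV l" for k
  proof -
    have "Ck_on k UNIV (\<lambda>t::real. sin (t / \<delta>))"
      by (rule Ck_on_compose[OF frame_real open_UNIV open_UNIV subset_UNIV
            Ck_on_bounded_linear[OF bounded_linear_divide] conjunct1[OF Ck_on_sin_cos]])
    then have "Ck_on k UNIV (\<lambda>t::real. sin (t / \<delta>) *\<^sub>R (\<delta> *\<^sub>R \<xi>))"
      by (rule Ck_on_scaleR[OF open_UNIV _ Ck_on_const])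
    from Ck_on_add[OF open_UNIV Ck_on_const this, of "\<Phi> a"] show ?thesis
      by (simp add: l_def[abs_def] mult.commute)
  qed
  define \<kappa> where "\<kappa> t = \<Psi> (l t)" for t
  have \<kappa>k: "Ck_on k UNIV \<kappa>" for k
    unfolding \<kappa>_def by (rule Ck_on_compose[OF B open_UNIV open_ball _ lk \<Psi>k]) (use lball in auto)
  have \<kappa>U: "\<kappa> t \<in> U" for t using \<Psi>[OF lball] by (simp add: \<kappa>_def)
  have \<kappa>0: "\<kappa> 0 = a" by (simp add: \<kappa>_def l_def \<Psi>a)
  \<comment> \<open>\<open>L\<close> cancels \<open>R\<close>, so the first two terms of
    \<open>\<Phi>\<close> have the same image under \<open>L\<close>. Hence
    \<open>F (\<Psi> y) = L y\<close>, and \<open>F\<close> is constant along lines in the kernel of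
    \<open>L\<close>.\<close>
  have L\<Phi>: "L (\<Phi> x) = F x" for x
    by (simp add: \<Phi>_def bounded_linear.linear[OF L] linear_add linear_diff LR)
  have F\<kappa>: "F (\<kappa> t) = F a" for t
  proof -
    have "F (\<kappa> t) = L (l t)" using \<Psi>[OF lball] L\<Phi>[of "\<kappa> t"] by (simp add: \<kappa>_def)
    also have "\<dots> = F a"
      using \<xi> by (simp add: l_def bounded_linear.linear[OF L] linear_add linear_cmul L\<Phi> L_def[symmetric])
    finally show ?thesis .
  qed
  have \<kappa>der: "(\<kappa> has_derivative (\<lambda>r. r *\<^sub>R \<xi>)) (at 0)"
  proof -
    have l0: "l 0 = \<Phi> a" by (simp add: l_def)
    \<comment> \<open>The factor \<open>\<delta>\<close> compensates the inner
      \<open>1 / \<delta>\<close>, so that the line is passed with velocity exactly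
      \<open>\<xi>\<close> at time 0.\<close>
    have "((\<lambda>t. \<delta> * sin (t / \<delta>)) has_derivative (\<lambda>r. r)) (at 0)"
      using \<delta> by (auto intro!: derivative_eq_intros)
    then have "((\<lambda>t. (\<delta> * sin (t / \<delta>)) *\<^sub>R \<xi>) has_derivative (\<lambda>r. r *\<^sub>R \<xi>)) (at 0)"
      by (rule has_derivative_scaleR_left)
    then have "(l has_derivative (\<lambda>r. 0 + r *\<^sub>R \<xi>)) (at 0)"
      unfolding l_def by (intro has_derivative_add has_derivative_const)
    from diff_chain_at[OF this, of \<Psi> "\<lambda>v. v"] show ?thesis
      using \<Psi>der by (simp add: l0 o_def \<kappa>_def[abs_def])
  qed
  define \<gamma> where "\<gamma> t = chart_inv c (\<kappa> t)" for t
  have \<kappa>im: "\<kappa> t \<in> snd c ` fst c" for t using \<kappa>U by (auto simp: U_def)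
  have c\<gamma>: "snd c (\<gamma> t) = \<kappa> t" for t unfolding \<gamma>_def by (rule chart_chart_inv[OF C c(1) \<kappa>im])
  have \<gamma>0: "\<gamma> 0 = p" by (simp add: \<gamma>_def \<kappa>0 inv_a)
  show ?thesis
  proof
    show "\<gamma> 0 = p" by (rule \<gamma>0)
    show "f (\<gamma> t) = f p" for t
    proof -
      \<comment> \<open>Coordinates in \<open>d\<close> determine a point only inside the chart
        domain, so membership has to be secured before coordinates are compared.\<close>
      have "f (\<gamma> t) \<in> fst d"
        using \<kappa>U[of t] chart_image_eq[OF C c(1), of "f -` fst d"] by (simp add: U_def \<gamma>_def)
      moreover have "snd d (f (\<gamma> t)) = snd d (f p)" using F\<kappa>[of t] by (simp add: F_def \<gamma>_def inv_a)
      ultimately show ?thesis using chart_inj[OF A d(1)] d(2) by (simp add: inj_on_eq_iff)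
    qed
    have "\<kappa> = snd (chart_at C (\<gamma> 0)) \<circ> \<gamma> \<circ> chart_inv (chart_at std_atlas 0)"
      by (simp add: \<gamma>0 c_def[symmetric] chart_at_std chart_inv_std c\<gamma> fun_eq_iff)
    then have "tangent_map std_atlas C \<gamma> 0 1 = 1 *\<^sub>R \<xi>"
      using \<kappa>der by (intro tangent_map_eqI) (simp add: chart_at_std)
    then show "tangent_map std_atlas C \<gamma> 0 1 = \<xi>" by simp
    have \<gamma>cont: "continuous_on UNIV \<gamma>"
      unfolding \<gamma>_def
      by (rule continuous_on_compose2[OF chart_inv_cont[OF C c(1)] Ck_on_imp_continuous_on[OF \<kappa>k]])
         (use \<kappa>im in auto)
    have "Ck_on k (\<gamma> -` fst c') (\<lambda>t. snd c' (\<gamma> t))" if c': "c' \<in> C" for c' k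
    proof -
      \<comment> \<open>Seen in another chart, the curve is \<open>\<kappa>\<close> followed by a
        transition map.\<close>
      have "Ck_on k (\<gamma> -` fst c') (\<lambda>t. (snd c' \<circ> (\<lambda>x. x) \<circ> chart_inv c) (\<kappa> t))"
      proof (rule Ck_on_compose[OF B _ _ _ Ck_on_subset[OF \<kappa>k subset_UNIV]
            smooth_mapD(3)[OF smooth_map_ident[OF C] c(1) c']])
        show "open (\<gamma> -` fst c')"
          by (rule continuous_on_open_vimage[OF open_UNIV, THEN iffD1, OF \<gamma>cont, rule_format, simplified])
             (rule chart_open[OF C c'])
        show "open (snd c ` (fst c \<inter> (\<lambda>x. x) -` fst c'))"
          by (rule chart_domain_open[OF C C continuous_on_id c(1) c'])
        show "\<kappa> ` (\<gamma> -` fst c') \<subseteq> snd c ` (fst c \<inter> (\<lambda>x. x) -` fst c')"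
          unfolding chart_image_eq[OF C c(1)] using \<kappa>im by (auto simp: \<gamma>_def)
      qed
      then show ?thesis by (simp add: \<gamma>_def)
    qed
    then show "smooth_map std_atlas C \<gamma>"
      using \<gamma>cont by (simp add: smooth_map_iff std_atlas_def chart_inv_std smooth_on_def o_def)
  qed
qed


section \<open>The Maurer-Cartan form\<close>

lemma one_form_linear_compose:
  assumes C: "smooth_atlas C" and P: "bounded_linear P" and \<omega>: "one_form C \<omega>"
  shows "one_form C (\<lambda>p v. P (\<omega> p v))"
  unfolding one_form_def
proof (intro conjI allI ballI)
  show "linear (\<lambda>v. P (\<omega> p v))" for p
    using \<omega> bounded_linear.linear[OF P] linear_compose[of "\<omega> p" P] by (simp add: one_form_def o_def)
  show "case c of (U, \<phi>) \<Rightarrow> \<forall>v. smooth_on (\<phi> ` U)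
      (\<lambda>y. P (\<omega> (chart_inv (U, \<phi>) y) (tangent_map std_atlas C (chart_inv (U, \<phi>)) y v)))" if "c \<in> C" for c
  proof -
    obtain U \<phi> where c: "c = (U, \<phi>)" by fastforce
    have "open (\<phi> ` U)" using chart_open_image[OF C that] by (simp add: c)
    moreover have "Ck_on k (\<phi> ` U) (\<lambda>y. \<omega> (chart_inv (U, \<phi>) y) (tangent_map std_atlas C (chart_inv (U, \<phi>)) y v))" for k v
      using \<omega> that by (auto simp: one_form_def smooth_on_def c)
    ultimately show ?thesis
      unfolding c by (simp add: smooth_on_def Ck_on_linear_compose[OF _ P])
  qed
qed

context
  fixes G :: "('g::{t2_space, second_countable_topology}, 'e::{real_inner, banach}) smooth_group"
  assumes lie: "lie_group G"
begin

lemma lie_group_group: "group G" and lie_group_carrier: "carrier G = UNIV"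
  and lie_group_atlas: "smooth_atlas (charts G)"
  using lie smooth_manifold_imp_smooth_atlas by (auto simp: lie_group_def)

text \<open>With group-valued maps on any atlas, translations, conjugations and the quotient map of
  pairs all arise from constants, identities and projections.\<close>

lemma smooth_map_mult:
  assumes X: "smooth_atlas X" and f: "smooth_map X (charts G) f" and g: "smooth_map X (charts G) g"
  shows "smooth_map X (charts G) (\<lambda>x. f x \<otimes>\<^bsub>G\<^esub> g x)"
proof -
  note C = lie_group_atlas
  have "smooth_map (prod_atlas (charts G) (charts G)) (charts G) (\<lambda>(a, b). a \<otimes>\<^bsub>G\<^esub> b)"
    using lie by (simp add: lie_group_def)
  from smooth_map_compose[OF X smooth_atlas_prod[OF C C] C smooth_map_Pair[OF chart_image_open[OF X] C C f g] this]
  show ?thesis by simp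
qed

lemma smooth_map_inverse:
  assumes X: "smooth_atlas X" and f: "smooth_map X (charts G) f"
  shows "smooth_map X (charts G) (\<lambda>x. inv\<^bsub>G\<^esub> f x)"
  by (rule smooth_map_compose[OF X lie_group_atlas lie_group_atlas f]) (use lie in \<open>simp add: lie_group_def\<close>)

lemma smooth_map_translations:
  "smooth_map (charts G) (charts G) (\<lambda>b. g \<otimes>\<^bsub>G\<^esub> b)"
  "smooth_map (charts G) (charts G) (\<lambda>b. b \<otimes>\<^bsub>G\<^esub> g)"
  "smooth_map (charts G) (charts G) (\<lambda>b. g \<otimes>\<^bsub>G\<^esub> b \<otimes>\<^bsub>G\<^esub> h)"
  by (intro smooth_map_mult smooth_map_const smooth_map_ident lie_group_atlas)+

lemma tangent_map_compose_group:
  assumes "smooth_map (charts G) (charts G) f" "smooth_atlas A" "smooth_map (charts G) A g"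
  shows "tangent_map (charts G) A g (f a) (tangent_map (charts G) (charts G) f a X)
    = tangent_map (charts G) A (\<lambda>b. g (f b)) a X"
  by (rule tangent_map_compose[symmetric])
     (intro lie_group_atlas smooth_map_tangent_diff assms)+

lemma left_mul_left_mul:
  "left_mul G h (k \<otimes>\<^bsub>G\<^esub> g) (left_mul G k g X) = left_mul G (h \<otimes>\<^bsub>G\<^esub> k) g X"
proof -
  interpret group G by (rule lie_group_group)
  show ?thesis
    unfolding left_mul_def
    by (subst tangent_map_compose_group[OF smooth_map_translations(1) lie_group_atlas smooth_map_translations(1)])
       (simp add: m_assoc[symmetric] lie_group_carrier)
qed

lemma left_mul_one: "left_mul G \<one>\<^bsub>G\<^esub> g X = X"
proof -
  interpret group G by (rule lie_group_group)
  show ?thesis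
    using tangent_map_ident[OF lie_group_atlas] by (simp add: left_mul_def lie_group_carrier)
qed

text \<open>Equivariance of the Maurer-Cartan form. Both sides are the tangent map at
  \<open>g\<close> of one map, which sends b to h^-1 g^-1 b h, factored once through a right
  translation and once through a conjugation based at the identity.\<close>

lemma left_mul_inv_right_mul:
  "left_mul G (inv\<^bsub>G\<^esub> (g \<otimes>\<^bsub>G\<^esub> h)) (g \<otimes>\<^bsub>G\<^esub> h) (right_mul G h g X)
    = Ad G (inv\<^bsub>G\<^esub> h) (left_mul G (inv\<^bsub>G\<^esub> g) g X)"
proof -
  interpret group G by (rule lie_group_group)
  note [simp] = lie_group_carrier
  have "left_mul G (inv\<^bsub>G\<^esub> (g \<otimes>\<^bsub>G\<^esub> h)) (g \<otimes>\<^bsub>G\<^esub> h) (right_mul G h g X)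
      = tangent_map (charts G) (charts G) (\<lambda>b. inv\<^bsub>G\<^esub> (g \<otimes>\<^bsub>G\<^esub> h) \<otimes>\<^bsub>G\<^esub> (b \<otimes>\<^bsub>G\<^esub> h)) g X"
    unfolding left_mul_def right_mul_def
    by (rule tangent_map_compose_group[OF smooth_map_translations(2) lie_group_atlas smooth_map_translations(1)])
  also have "(\<lambda>b. inv\<^bsub>G\<^esub> (g \<otimes>\<^bsub>G\<^esub> h) \<otimes>\<^bsub>G\<^esub> (b \<otimes>\<^bsub>G\<^esub> h))
      = (\<lambda>b. inv\<^bsub>G\<^esub> h \<otimes>\<^bsub>G\<^esub> (inv\<^bsub>G\<^esub> g \<otimes>\<^bsub>G\<^esub> b) \<otimes>\<^bsub>G\<^esub> inv\<^bsub>G\<^esub> (inv\<^bsub>G\<^esub> h))"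
    by (simp add: inv_mult_group m_assoc)
  also have "tangent_map (charts G) (charts G) \<dots> g X
      = tangent_map (charts G) (charts G) (\<lambda>b. inv\<^bsub>G\<^esub> h \<otimes>\<^bsub>G\<^esub> b \<otimes>\<^bsub>G\<^esub> inv\<^bsub>G\<^esub> (inv\<^bsub>G\<^esub> h)) (inv\<^bsub>G\<^esub> g \<otimes>\<^bsub>G\<^esub> g)
          (left_mul G (inv\<^bsub>G\<^esub> g) g X)"
    unfolding left_mul_def
    by (rule tangent_map_compose_group[OF smooth_map_translations(1) lie_group_atlas smooth_map_translations(3), symmetric])
  finally show ?thesis by (simp add: Ad_def)
qed

text \<open>In the chart \<open>c\<close> the form is the partial derivative on the diagonal of \<open>(w, z) \<mapsto> w\<^sup>-\<^sup>1z\<close> with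
  respect to \<open>z\<close>.\<close>
lemma one_form_Maurer_Cartan: "one_form (charts G) (\<lambda>g. left_mul G (inv\<^bsub>G\<^esub> g) g)"
proof -
  interpret group G by (rule lie_group_group)
  note C = lie_group_atlas and [simp] = lie_group_carrier
  let ?C = "charts G"
  obtain B :: "'e set" where B: "frame B" using smooth_atlas_frame[OF C] by blast
  obtain BB :: "('e \<times> 'e) set" where BB: "frame BB" using frame_prod[OF B B] by blast
  note CC = smooth_atlas_prod[OF C C]
  have q: "smooth_map (prod_atlas ?C ?C) ?C (\<lambda>x. inv\<^bsub>G\<^esub> (fst x) \<otimes>\<^bsub>G\<^esub> snd x)"
    by (intro smooth_map_mult smooth_map_inverse CC smooth_map_fst smooth_map_snd C)
  \<comment> \<open>All values of the form are tangent at the identity, so one output chart serves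
    for every base point.\<close>
  define c1 where "c1 = chart_at ?C \<one>\<^bsub>G\<^esub>"
  have c1: "c1 \<in> ?C" "\<one>\<^bsub>G\<^esub> \<in> fst c1" unfolding c1_def by (rule chart_at[OF C])+
  have "smooth_on (snd c ` fst c) (\<lambda>y. left_mul G (inv\<^bsub>G\<^esub> (chart_inv c y)) (chart_inv c y)
      (tangent_map std_atlas ?C (chart_inv c) y v))" if c: "c \<in> ?C" for c v
  proof -
    define e where "e = (fst c \<times> fst c, map_prod (snd c) (snd c))"
    have e: "e \<in> prod_atlas ?C ?C" using c by (auto simp: prod_atlas_iff e_def)
    define K where "K = snd c1 \<circ> (\<lambda>x. inv\<^bsub>G\<^esub> (fst x) \<otimes>\<^bsub>G\<^esub> snd x) \<circ> chart_inv e"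
    define W where "W = snd e ` (fst e \<inter> (\<lambda>x. inv\<^bsub>G\<^esub> (fst x) \<otimes>\<^bsub>G\<^esub> snd x) -` fst c1)"
    let ?S = "snd c ` fst c"
    have S: "open ?S" by (rule chart_open_image[OF C c])
    have W: "open W" unfolding W_def by (rule chart_domain_open[OF CC C smooth_mapD(1)[OF q] e c1(1)])
    have Kk: "Ck_on k W K" for k unfolding W_def K_def by (rule smooth_mapD(3)[OF q e c1(1)])
    have diag: "(y, y) \<in> W" if y: "y \<in> ?S" for y
    proof -
      obtain p where p: "p \<in> fst c" "y = snd c p" using y by blast
      then have "(p, p) \<in> fst e \<inter> (\<lambda>x. inv\<^bsub>G\<^esub> (fst x) \<otimes>\<^bsub>G\<^esub> snd x) -` fst c1"
        using c1(2) by (simp add: e_def)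
      moreover have "snd e (p, p) = (y, y)" by (simp add: e_def p)
      ultimately show ?thesis unfolding W_def by (metis imageI)
    qed
    have "left_mul G (inv\<^bsub>G\<^esub> (chart_inv c y)) (chart_inv c y) (tangent_map std_atlas ?C (chart_inv c) y v)
        = frechet_derivative K (at (y, y)) (0, v)" if y: "y \<in> ?S" for y
    proof -
      let ?g = "chart_inv c y" and ?h = "\<lambda>z. inv\<^bsub>G\<^esub> (chart_inv c y) \<otimes>\<^bsub>G\<^esub> chart_inv c z"
      have "left_mul G (inv\<^bsub>G\<^esub> ?g) ?g (tangent_map std_atlas ?C (chart_inv c) y v)
          = tangent_map std_atlas ?C ?h y v"
        unfolding left_mul_def
        by (rule tangent_map_compose[symmetric, OF smooth_atlas_std[OF B] C tangent_diff_chart_inv[OF C c y]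
              smooth_map_tangent_diff[OF C C smooth_map_translations(1)]])
      also have "\<dots> = frechet_derivative K (at (y, y)) (0, v)"
      proof (rule tangent_map_eqI)
        have "(K has_derivative frechet_derivative K (at (y, y))) (at (y, y))"
          by (rule Ck_on_SucD(1)[OF Kk diag[OF y]])
        moreover have "((\<lambda>z. (y, z)) has_derivative (\<lambda>v. (0, v))) (at y)"
          by (intro has_derivative_Pair has_derivative_const has_derivative_ident)
        ultimately have "((\<lambda>z. K (y, z)) has_derivative (\<lambda>v. frechet_derivative K (at (y, y)) (0, v))) (at y)"
          using diff_chain_at[of "\<lambda>z. (y, z)" "\<lambda>v. (0, v)" y K] by (simp add: o_def)
        then have "((\<lambda>z. snd c1 (?h z)) has_derivative (\<lambda>v. frechet_derivative K (at (y, y)) (0, v))) (at y)"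
          by (rule has_derivative_transform_within_open[OF _ S y])
             (simp add: K_def e_def chart_inv_prod[OF C C c c y])
        then show "(snd (chart_at ?C (?h y)) \<circ> ?h \<circ> chart_inv (chart_at std_atlas y) has_derivative
            (\<lambda>v. frechet_derivative K (at (y, y)) (0, v))) (at (snd (chart_at std_atlas y) y))"
          by (simp add: chart_at_std chart_inv_std c1_def o_def)
      qed
      finally show ?thesis .
    qed
    moreover have "Ck_on k ?S (\<lambda>y. frechet_derivative K (at (y, y)) (0, v))" for k
    proof (rule Ck_on_compose[OF BB S W])
      show "Ck_on k ?S (\<lambda>y. (y, y))"
        by (intro Ck_on_bounded_linear bounded_linear_Pair bounded_linear_ident)
      show "Ck_on k W (\<lambda>x. frechet_derivative K (at x) (0, v))"
        by (rule Ck_on_SucD(2)[OF Kk])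
    qed (use diag in auto)
    ultimately show ?thesis
      unfolding smooth_on_def using Ck_on_cong[OF S] by (metis (no_types, lifting))
  qed
  moreover have "linear (left_mul G (inv\<^bsub>G\<^esub> g) g)" for g
    unfolding left_mul_def[abs_def]
    by (rule bounded_linear.linear[OF tangent_map_bounded_linear[OF
          smooth_map_tangent_diff[OF C C smooth_map_translations(1)]]])
  ultimately show ?thesis by (fastforce simp: one_form_def)
qed

end


section \<open>The principal connection of a connection on a homogeneous space\<close>

context
  fixes G :: "('g::{t2_space, second_countable_topology}, 'e::{real_inner, banach}) smooth_group"
    and A :: "('m::{t2_space, second_countable_topology}, 'f::{real_inner, banach}) atlas"
    and act :: "'g \<Rightarrow> 'm \<Rightarrow> 'm"
  assumes hom: "homogeneous_space G A act"
begin

lemma homogeneous_lie: "lie_group G"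
  and homogeneous_atlas: "smooth_atlas A"
  and homogeneous_action: "group_action G UNIV act"
  using hom smooth_manifold_imp_smooth_atlas by (auto simp: homogeneous_space_def transitive_action_def)

lemma act_mult: "act (g \<otimes>\<^bsub>G\<^esub> h) x = act g (act h x)"
  using group_action.composition_rule[OF homogeneous_action] lie_group_carrier[OF homogeneous_lie] by simp

lemma act_one: "act \<one>\<^bsub>G\<^esub> x = x"
  using fun_cong[OF group_action.id_eq_one[OF homogeneous_action], of x] by simp

lemma smooth_map_act: "smooth_map A A (act g)" and smooth_map_orbit: "smooth_map (charts G) A (\<lambda>a. act a x)"
proof -
  note C = lie_group_atlas[OF homogeneous_lie] and A = homogeneous_atlas
  have s: "smooth_map (prod_atlas (charts G) A) A (\<lambda>(g, x). act g x)"
    using hom by (simp add: homogeneous_space_def)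
  show "smooth_map A A (act g)"
    using smooth_map_compose[OF A smooth_atlas_prod[OF C A] A
        smooth_map_Pair[OF chart_image_open[OF A] C A smooth_map_const smooth_map_ident[OF A]] s] by simp
  show "smooth_map (charts G) A (\<lambda>a. act a x)"
    using smooth_map_compose[OF C smooth_atlas_prod[OF C A] A
        smooth_map_Pair[OF chart_image_open[OF C] C A smooth_map_ident[OF C] smooth_map_const] s] by simp
qed

lemma tangent_map_act_orbit:
  "tangent_map A A (act g) (act a x) (tangent_map (charts G) A (\<lambda>a. act a x) a X)
    = tangent_map (charts G) A (\<lambda>a. act (g \<otimes>\<^bsub>G\<^esub> a) x) a X"
  unfolding act_mult
  by (rule tangent_map_compose[symmetric])
     (intro lie_group_atlas homogeneous_lie homogeneous_atlas smooth_map_tangent_diff smooth_map_act smooth_map_orbit)+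

lemma tangent_map_orbit_compose:
  assumes "smooth_map (charts G) (charts G) f"
  shows "tangent_map (charts G) A (\<lambda>a. act a x) (f a) (tangent_map (charts G) (charts G) f a X)
    = tangent_map (charts G) A (\<lambda>a. act (f a) x) a X"
  by (rule tangent_map_compose_group[OF homogeneous_lie assms homogeneous_atlas smooth_map_orbit])

lemma tangent_map_orbit_linear: "bounded_linear (tangent_map (charts G) A (\<lambda>a. act a x) a)"
  by (intro tangent_map_bounded_linear smooth_map_tangent_diff homogeneous_atlas smooth_map_orbit
      lie_group_atlas homogeneous_lie)

section \<open>The isotropy algebra and the vertical projection\<close>

context
  fixes \<omega> :: "'m \<Rightarrow> 'f \<Rightarrow> 'e" and x :: 'm
  assumes conn: "connection G A act \<omega>"
begin

lemma connection_bounded_linear: "bounded_linear (\<omega> y)"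
proof -
  obtain B :: "'f set" where "frame B" using smooth_atlas_frame[OF homogeneous_atlas] by blast
  moreover have "linear (\<omega> y)" using conn by (simp add: connection_def one_form_def)
  ultimately show ?thesis by (rule frame_linear_bounded)
qed

lemma connection_section: "tangent_map (charts G) A (\<lambda>a. act a y) \<one>\<^bsub>G\<^esub> (\<omega> y f) = f"
  using conn by (simp add: connection_def inf_action_def)

lemma connection_equivariant: "\<omega> (act g y) (tangent_map A A (act g) y f) = Ad G g (\<omega> y f)"
  using conn lie_group_carrier[OF homogeneous_lie] by (simp add: connection_def)

text \<open>The orbit map is constant along a curve in the isotropy group, which gives one inclusion
  by the chain rule; the other is the existence of curves in the fibre of the orbit map over
  \<open>x\<close>.\<close>

lemma lie_subalgebra_stabilizer:
  "lie_subalgebra G (stabilizer G act x) = {\<xi>. tangent_map (charts G) A (\<lambda>a. act a x) \<one>\<^bsub>G\<^esub> \<xi> = 0}"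
proof (intro equalityI subsetI)
  note C = lie_group_atlas[OF homogeneous_lie] and A = homogeneous_atlas
  let ?L = "tangent_map (charts G) A (\<lambda>a. act a x)"
  fix \<xi>
  {
    assume "\<xi> \<in> lie_subalgebra G (stabilizer G act x)"
    then obtain \<gamma> where \<gamma>: "smooth_map std_atlas (charts G) \<gamma>" "\<gamma> (0::real) = \<one>\<^bsub>G\<^esub>" "range \<gamma> \<subseteq> stabilizer G act x"
      "\<xi> = tangent_map std_atlas (charts G) \<gamma> 0 1"
      by (auto simp: lie_subalgebra_def)
    note R = smooth_atlas_std[OF frame_real]
    have "?L (\<gamma> 0) (tangent_map std_atlas (charts G) \<gamma> 0 1) = tangent_map std_atlas A (\<lambda>t. act (\<gamma> t) x) 0 1"
      by (rule tangent_map_compose[OF R C, symmetric])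
         (intro smooth_map_tangent_diff R C A \<gamma>(1) smooth_map_orbit)+
    also have "(\<lambda>t. act (\<gamma> t) x) = (\<lambda>_. x)" using \<gamma>(3) by (auto simp: stabilizer_def)
    finally have "?L \<one>\<^bsub>G\<^esub> \<xi> = 0" by (simp add: \<gamma> tangent_map_const)
    then show "\<xi> \<in> {\<xi>. ?L \<one>\<^bsub>G\<^esub> \<xi> = 0}" by simp
  next
    assume "\<xi> \<in> {\<xi>. ?L \<one>\<^bsub>G\<^esub> \<xi> = 0}"
    then have "?L \<one>\<^bsub>G\<^esub> \<xi> = 0" by simp
    \<comment> \<open>The right inverse \<open>R\<close> of the differential is
      \<open>\<omega> x\<close>: this is the section property of the connection.\<close>
    from submersion_fibre_curve[OF C A smooth_map_orbit connection_bounded_linear connection_section this]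
    obtain \<gamma> where \<gamma>: "smooth_map std_atlas (charts G) \<gamma>" "\<gamma> (0::real) = \<one>\<^bsub>G\<^esub>"
      "\<And>t. act (\<gamma> t) x = act \<one>\<^bsub>G\<^esub> x" "tangent_map std_atlas (charts G) \<gamma> 0 1 = \<xi>" by blast
    moreover have "range \<gamma> \<subseteq> stabilizer G act x"
      using \<gamma>(3) act_one lie_group_carrier[OF homogeneous_lie] by (auto simp: stabilizer_def)
    ultimately show "\<xi> \<in> lie_subalgebra G (stabilizer G act x)"
      unfolding lie_subalgebra_def by blast
  }
qed

text \<open>The linear projection onto the isotropy algebra along the image of
  \<open>\<omega> x\<close>, which is the horizontal space at the identity.\<close>

definition vertical_part :: "'e \<Rightarrow> 'e" where
  "vertical_part \<xi> = \<xi> - \<omega> x (tangent_map (charts G) A (\<lambda>a. act a x) \<one>\<^bsub>G\<^esub> \<xi>)"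

lemma vertical_part_bounded_linear: "bounded_linear vertical_part"
  unfolding vertical_part_def[abs_def]
  by (intro bounded_linear_sub bounded_linear_ident bounded_linear_compose[OF connection_bounded_linear]
      tangent_map_orbit_linear)

lemma vertical_part_in: "vertical_part \<xi> \<in> lie_subalgebra G (stabilizer G act x)"
  unfolding lie_subalgebra_stabilizer vertical_part_def
  by (simp add: linear_diff[OF bounded_linear.linear[OF tangent_map_orbit_linear]] connection_section)

lemma vertical_part_id: "\<xi> \<in> lie_subalgebra G (stabilizer G act x) \<Longrightarrow> vertical_part \<xi> = \<xi>"
  unfolding lie_subalgebra_stabilizer vertical_part_def
  by (simp add: linear_0[OF bounded_linear.linear[OF connection_bounded_linear]])

lemma vertical_part_Ad:
  assumes h: "h \<in> stabilizer G act x"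
  shows "vertical_part (Ad G (inv\<^bsub>G\<^esub> h) \<xi>) = Ad G (inv\<^bsub>G\<^esub> h) (vertical_part \<xi>)"
proof -
  interpret group G by (rule lie_group_group[OF homogeneous_lie])
  note [simp] = lie_group_carrier[OF homogeneous_lie]
  let ?L = "tangent_map (charts G) A (\<lambda>a. act a x)" and ?k = "inv\<^bsub>G\<^esub> h"
  have hx: "act h x = x" using h by (simp add: stabilizer_def)
  have kx: "act ?k x = x" using act_mult[of ?k h x] hx act_one by simp
  have Adlin: "linear (Ad G ?k)"
    unfolding Ad_def[abs_def]
    by (intro bounded_linear.linear tangent_map_bounded_linear smooth_map_tangent_diff
        lie_group_atlas smooth_map_translations homogeneous_lie)
  have "?L \<one>\<^bsub>G\<^esub> (Ad G ?k \<xi>) = tangent_map (charts G) A (\<lambda>a. act (?k \<otimes>\<^bsub>G\<^esub> a \<otimes>\<^bsub>G\<^esub> inv\<^bsub>G\<^esub> ?k) x) \<one>\<^bsub>G\<^esub> \<xi>"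
    using tangent_map_orbit_compose[OF smooth_map_translations(3)[OF homogeneous_lie, of ?k "inv\<^bsub>G\<^esub> ?k"],
        of x "\<one>\<^bsub>G\<^esub>" \<xi>]
    by (simp add: Ad_def)
  \<comment> \<open>The right-hand factor is \<open>h\<close>, which fixes \<open>x\<close>; on the
    orbit map, conjugation thus acts as a left translation.\<close>
  also have "(\<lambda>a. act (?k \<otimes>\<^bsub>G\<^esub> a \<otimes>\<^bsub>G\<^esub> inv\<^bsub>G\<^esub> ?k) x) = (\<lambda>a. act (?k \<otimes>\<^bsub>G\<^esub> a) x)"
    by (simp add: act_mult hx)
  also have "tangent_map (charts G) A \<dots> \<one>\<^bsub>G\<^esub> \<xi> = tangent_map A A (act ?k) x (?L \<one>\<^bsub>G\<^esub> \<xi>)"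
    using tangent_map_act_orbit[of ?k "\<one>\<^bsub>G\<^esub>" x \<xi>] by (simp add: act_one)
  finally have "\<omega> x (?L \<one>\<^bsub>G\<^esub> (Ad G ?k \<xi>)) = \<omega> (act ?k x) (tangent_map A A (act ?k) x (?L \<one>\<^bsub>G\<^esub> \<xi>))"
    by (simp add: kx)
  also have "\<dots> = Ad G ?k (\<omega> x (?L \<one>\<^bsub>G\<^esub> \<xi>))" by (rule connection_equivariant)
  finally show ?thesis by (simp add: vertical_part_def linear_diff[OF Adlin])
qed

text \<open>The orbit map intertwines left translations with the action. Acting with the inverse of
  \<open>g\<close> therefore brings \<open>\<omega>\<close> back to the point \<open>x\<close> and
  its argument to the image of the left-translated \<open>X\<close>.\<close>

lemma vertical_part_Maurer_Cartan:
  "left_mul G (inv\<^bsub>G\<^esub> g) g X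
     - Ad G (inv\<^bsub>G\<^esub> g) (\<omega> (act g x) (tangent_map (charts G) A (\<lambda>a. act a x) g X))
   = vertical_part (left_mul G (inv\<^bsub>G\<^esub> g) g X)"
proof -
  interpret group G by (rule lie_group_group[OF homogeneous_lie])
  note [simp] = lie_group_carrier[OF homogeneous_lie]
  let ?L = "tangent_map (charts G) A (\<lambda>a. act a x)" and ?k = "inv\<^bsub>G\<^esub> g"
  have "Ad G ?k (\<omega> (act g x) (?L g X)) = \<omega> (act ?k (act g x)) (tangent_map A A (act ?k) (act g x) (?L g X))"
    by (rule connection_equivariant[symmetric])
  also have "act ?k (act g x) = x" using act_mult[of ?k g x] act_one by simp
  also have "tangent_map A A (act ?k) (act g x) (?L g X) = ?L (?k \<otimes>\<^bsub>G\<^esub> g) (left_mul G ?k g X)"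
    unfolding tangent_map_act_orbit left_mul_def
    by (rule tangent_map_orbit_compose[OF smooth_map_translations(1)[OF homogeneous_lie], symmetric])
  finally show ?thesis by (simp add: vertical_part_def)
qed

end

end

theorem proposition4p9:
  fixes G :: "('g::{t2_space, second_countable_topology}, 'e::{real_inner, banach}) smooth_group"
    and A :: "('m::{t2_space, second_countable_topology}, 'f::{real_inner, banach}) atlas"
    and act :: "'g \<Rightarrow> 'm \<Rightarrow> 'm"
    and orig :: 'm
    and H :: "'g set"
    and \<omega> :: "'m \<Rightarrow> 'f \<Rightarrow> 'e"
    and \<theta> :: "'g \<Rightarrow> 'e \<Rightarrow> 'e"
  assumes "homogeneous_space G A act"
    and "H = stabilizer G act orig"
    and "connection G A act \<omega>"
    and "\<And>g X. \<theta> g X =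
           left_mul G (inv\<^bsub>G\<^esub> g) g X -
           Ad G (inv\<^bsub>G\<^esub> g)
             (\<omega> (act g orig) (tangent_map (charts G) A (\<lambda>a. act a orig) g X))"
  shows "(\<forall>g X. \<theta> g X \<in> lie_subalgebra G H) \<and>
         principal_connection G H \<theta> \<and> invariant_form G \<theta>"
proof -
  note lie = homogeneous_lie[OF assms(1)] and conn = assms(1,3)
  interpret group G by (rule lie_group_group[OF lie])
  note [simp] = lie_group_carrier[OF lie]
  let ?P = "vertical_part G A act \<omega> orig"
  have \<theta>: "\<theta> = (\<lambda>g X. ?P (left_mul G (inv\<^bsub>G\<^esub> g) g X))"
    by (intro ext) (simp only: assms(4) vertical_part_Maurer_Cartan[OF conn])
  have form: "one_form (charts G) \<theta>"
    unfolding \<theta>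
    by (rule one_form_linear_compose[OF lie_group_atlas[OF lie] vertical_part_bounded_linear[OF conn]
          one_form_Maurer_Cartan[OF lie]])
  have vert: "\<theta> g X \<in> lie_subalgebra G H" for g X
    unfolding \<theta> assms(2) by (rule vertical_part_in[OF conn])
  have equiv: "\<theta> (g \<otimes>\<^bsub>G\<^esub> h) (right_mul G h g X) = Ad G (inv\<^bsub>G\<^esub> h) (\<theta> g X)" if "h \<in> H" for h g X
    using that unfolding \<theta> assms(2) left_mul_inv_right_mul[OF lie] by (rule vertical_part_Ad[OF conn])
  \<comment> \<open>Left invariance of the Maurer-Cartan form. With the identity as base point it
    also evaluates the form on the vectors g \<xi>.\<close>
  have inv_left: "left_mul G (inv\<^bsub>G\<^esub> (k \<otimes>\<^bsub>G\<^esub> g)) (k \<otimes>\<^bsub>G\<^esub> g) (left_mul G k g X) = left_mul G (inv\<^bsub>G\<^esub> g) g X" for k g X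
    unfolding left_mul_left_mul[OF lie] by (simp add: inv_mult_group m_assoc)
  have repr: "\<theta> g (left_mul G g \<one>\<^bsub>G\<^esub> \<xi>) = \<xi>" if "\<xi> \<in> lie_subalgebra G H" for g \<xi>
    using inv_left[of g "\<one>\<^bsub>G\<^esub>" \<xi>] vertical_part_id[OF conn] that
    unfolding \<theta> assms(2) by (simp add: left_mul_one[OF lie])
  have "\<theta> (k \<otimes>\<^bsub>G\<^esub> g) (left_mul G k g X) = \<theta> g X" for k g X
    unfolding \<theta> inv_left ..
  then show ?thesis
    using form vert equiv repr by (simp add: principal_connection_def invariant_form_def)
qed

end
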